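(* Let $a$ and $b$ be integers with $(a,b)\neq(0,0)$ and $a\equiv 3b\pmod 5$. Then the function $$f_{a,b}(\tau):=r(\tau)^a r(2\tau)^b+\frac{(-1)^{b-a}}{r(\tau)^a r(2\tau)^b}$$ is a modular function on $\Gamma_0(10)$. In addition, there is a polynomial $Q\in\mathbb{Q}[X]$ such that $$\big(l(\tau)-1/l(\tau)\big)^{|a+2b|/5} f_{a,b}(\tau)=Q\big(l(\tau)-1/l(\tau)\big).$$
   Context: For $\tau\in\mathbb{H}$ put $q=e^{2\pi i\tau}$ and let $r(\tau)=q^{1/5}\prod_{n\ge1}\frac{(1-q^{5n-1})(1-q^{5n-4})}{(1-q^{5n-2})(1-q^{5n-3})}$ be the Rogers–Ramanujan continued fraction. Define $l(\tau)=r(2\tau)/r(\tau)^2$. $\Gamma_0(N)=\{\left[\begin{smallmatrix}a&b\\c&d\end{smallmatrix}\right]\in\mathrm{SL}_2(\mathbb{Z}): c\equiv0\pmod N\}$. A modular function on a congruence subgroup $\Gamma$ is a function meromorphic on $\mathbb{H}$, $\Gamma$-invariant, and meromorphic at all cusps. (Note $a\equiv3b\pmod5$ implies $5\mid a+2b$.) *)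

theory Defs
  imports
    "HOL-Complex_Analysis.Complex_Analysis"
    "HOL-Number_Theory.Cong"
begin

definition upper_half_plane :: "complex set" where
  "upper_half_plane = {\<tau>. Im \<tau> > 0}"

definition rr_cfrac :: "complex \<Rightarrow> complex" where
  "rr_cfrac \<tau> =
     (let q = exp (2 * of_real pi * \<i> * \<tau>)
      in exp (2 * of_real pi * \<i> * \<tau> / 5) *
         (\<Prod>m. let n = Suc m in
               ((1 - q ^ (5 * n - 1)) * (1 - q ^ (5 * n - 4))) /
               ((1 - q ^ (5 * n - 2)) * (1 - q ^ (5 * n - 3)))))"

definition rr_l :: "complex \<Rightarrow> complex" where
  "rr_l \<tau> = rr_cfrac (2 * \<tau>) / rr_cfrac \<tau> ^ 2"

definition rr_f :: "int \<Rightarrow> int \<Rightarrow> complex \<Rightarrow> complex" where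
  "rr_f a b \<tau> =
     rr_cfrac \<tau> powi a * rr_cfrac (2 * \<tau>) powi b +
     (- 1) powi (b - a) / (rr_cfrac \<tau> powi a * rr_cfrac (2 * \<tau>) powi b)"

definition SL2Z :: "(int ^ 2 ^ 2) set" where
  "SL2Z = {A. det A = 1}"

definition Gamma0 :: "nat \<Rightarrow> (int ^ 2 ^ 2) set" where
  "Gamma0 N = {A \<in> SL2Z. [A $ 2 $ 1 = 0] (mod int N)}"

definition moebius :: "int ^ 2 ^ 2 \<Rightarrow> complex \<Rightarrow> complex" where
  "moebius A \<tau> =
     (of_int (A $ 1 $ 1) * \<tau> + of_int (A $ 1 $ 2)) /
     (of_int (A $ 2 $ 1) * \<tau> + of_int (A $ 2 $ 2))"

text \<open>
  A function is meromorphic at \<open>\<i>\<infinity>\<close> if, near \<open>\<i>\<infinity>\<close>, it is given by a Laurent series with finite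
  principal part in the local parameter \<open>exp (2 \<pi> \<i> \<tau> / h)\<close>. The width \<open>h\<close> need not be minimal.
\<close>
definition meromorphic_at_ii_inf :: "(complex \<Rightarrow> complex) \<Rightarrow> bool" where
  "meromorphic_at_ii_inf f \<longleftrightarrow>
     (\<exists>h::nat. h > 0 \<and>
        (\<exists>g c. g meromorphic_on {0} \<and>
           (\<forall>\<tau>. Im \<tau> > c \<longrightarrow> f \<tau> = g (exp (2 * of_real pi * \<i> * \<tau> / of_nat h)))))"

text \<open>
  Every cusp is \<open>A \<infinity>\<close> for some \<open>A\<close> in \<open>SL2Z\<close>, so meromorphy at all cusps is tested on all
  translates \<open>f \<circ> moebius A\<close>. The library's \<open>meromorphic_on\<close> ignores the values of a function at
  isolated points; \<open>nicely_meromorphic_on\<close> rules out removable singularities and fixes the value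
  \<open>0\<close> at poles, so that pointwise invariance is the right notion.
\<close>
definition modular_function_on :: "(int ^ 2 ^ 2) set \<Rightarrow> (complex \<Rightarrow> complex) \<Rightarrow> bool" where
  "modular_function_on \<Gamma> f \<longleftrightarrow>
     f nicely_meromorphic_on upper_half_plane \<and>
     (\<forall>A\<in>\<Gamma>. \<forall>\<tau>\<in>upper_half_plane. f (moebius A \<tau>) = f \<tau>) \<and>
     (\<forall>A\<in>SL2Z. meromorphic_at_ii_inf (\<lambda>\<tau>. f (moebius A \<tau>)))"

end

theory Submission imports Defs begin

text \<open>
  Let \<open>\<wp>\<^sub>j\<close> be the value at \<open>j\<tau>\<close> of the Weierstrass function of the lattice \<open>\<int>10\<tau> + \<int>\<close>. By the
  formula expressing \<open>\<wp>(a) - \<wp>(b)\<close> as a quotient of theta functions, the product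
  \<open>k = r(\<tau>) r(2\<tau>)\<^sup>2\<close> satisfies \<open>1/k = (\<wp>\<^sub>1 - \<wp>\<^sub>2) / (\<wp>\<^sub>2 - \<wp>\<^sub>4)\<close>, while
  \<open>l = (\<wp>\<^sub>1 - \<wp>\<^sub>4)(\<wp>\<^sub>3 - \<wp>\<^sub>4) / ((\<wp>\<^sub>2 - \<wp>\<^sub>3)(\<wp>\<^sub>2 - \<wp>\<^sub>4))\<close>, and
  \<open>(\<wp>\<^sub>1 - \<wp>\<^sub>2)(\<wp>\<^sub>3 - \<wp>\<^sub>4) = (\<wp>\<^sub>2 - \<wp>\<^sub>4)\<^sup>2\<close>. Hence \<open>l = (1 + k) / (1 - k)\<close>.

  A matrix in \<open>\<Gamma>\<^sub>0(10)\<close> with upper left entry \<open>a\<close> replaces \<open>\<wp>\<^sub>j\<close> by \<open>\<wp>\<^sub>a\<^sub>j\<close> up to a common affine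
  map, so it sends \<open>k\<close> to \<open>k\<close> or \<open>-1/k\<close> and fixes \<open>t = l - 1/l = 4k/(1 - k\<^sup>2)\<close>. Finally
  \<open>r(\<tau>)\<^sup>a r(2\<tau>)\<^sup>b = k\<^sup>n l\<^sup>m\<close> with \<open>n = (a + 2b)/5\<close> and \<open>m = b - 2n\<close>. The expression
  \<open>k\<^sup>n l\<^sup>m + (-1)\<^bsup>n+m\<^esup> k\<^bsup>-n\<^esup> l\<^bsup>-m\<^esup>\<close> obeys three-term recurrences in \<open>n\<close> and \<open>m\<close> with
  coefficients \<open>k - 1/k = -4/t\<close> and \<open>l - 1/l = t\<close>, so it is \<open>t\<^bsup>-|n|\<^esup>\<close> times a polynomial in \<open>t\<close>.
\<close>

section \<open>The q-Pochhammer symbol\<close>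

definition qpoch :: "complex \<Rightarrow> complex \<Rightarrow> complex" where
  "qpoch x q = (\<Prod>n. 1 - x * q ^ n)"

lemma convergent_prod_qpoch:
  assumes "norm q < 1"
  shows "convergent_prod (\<lambda>n. 1 - x * q ^ n :: complex)"
proof (rule abs_convergent_prod_imp_convergent_prod, rule summable_imp_abs_convergent_prod)
  have "summable (\<lambda>n. norm x * norm q ^ n)"
    using assms by (intro summable_mult summable_geometric) auto
  then show "summable (\<lambda>n. norm (1 - x * q ^ n - 1))"
    by (simp add: norm_mult norm_power)
qed

lemma qpoch_tendsto:
  assumes "norm q < 1"
  shows "(\<lambda>N. \<Prod>n<N. 1 - x * q ^ n) \<longlonglongrightarrow> qpoch x q"
  unfolding qpoch_def
  by (rule has_prod_imp_tendsto', rule convergent_prod_has_prod, rule convergent_prod_qpoch, rule assms)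

lemma qpoch_eq_0_iff:
  assumes "norm q < 1"
  shows "qpoch x q = 0 \<longleftrightarrow> (\<exists>n. x * q ^ n = 1)"
proof -
  have "(\<lambda>n. 1 - x * q ^ n) has_prod qpoch x q"
    unfolding qpoch_def by (intro convergent_prod_has_prod convergent_prod_qpoch assms)
  from has_prod_eq_0_iff[OF this] show ?thesis
    by (auto simp: image_iff)
qed

lemma qpoch_rec:
  assumes "norm q < 1"
  shows "qpoch x q = (1 - x) * qpoch (x * q) q"
proof (rule LIMSEQ_unique)
  show "(\<lambda>N. \<Prod>n<Suc N. 1 - x * q ^ n) \<longlonglongrightarrow> qpoch x q"
    using qpoch_tendsto[OF assms, of x] by (rule LIMSEQ_Suc)
  have "(\<lambda>N. (1 - x) * (\<Prod>n<N. 1 - x * q * q ^ n)) \<longlonglongrightarrow> (1 - x) * qpoch (x * q) q"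
    by (intro tendsto_intros qpoch_tendsto assms)
  also have "(\<lambda>N. (1 - x) * (\<Prod>n<N. 1 - x * q * q ^ n)) = (\<lambda>N. \<Prod>n<Suc N. 1 - x * q ^ n)"
    by (subst prod.lessThan_Suc_shift) (simp add: mult.assoc)
  finally show "(\<lambda>N. \<Prod>n<Suc N. 1 - x * q ^ n) \<longlonglongrightarrow> (1 - x) * qpoch (x * q) q" .
qed

text \<open>The factors are sorted by the parity of the exponent of \<open>q\<close>.\<close>

lemma qpoch_square:
  assumes "norm q < 1"
  shows "qpoch x q = qpoch x (q\<^sup>2) * qpoch (x * q) (q\<^sup>2)"
proof (rule LIMSEQ_unique)
  have q2: "norm (q\<^sup>2) < 1"
    using assms by (simp add: norm_power power_less_one_iff)
  have "filterlim (\<lambda>N::nat. 2 * N) at_top at_top"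
    by (simp add: filterlim_subseq strict_mono_def)
  with qpoch_tendsto[OF assms, of x]
  show "(\<lambda>N. \<Prod>n<2*N. 1 - x * q ^ n) \<longlonglongrightarrow> qpoch x q"
    by (rule filterlim_compose)
  have "(\<lambda>N. (\<Prod>n<N. 1 - x * (q\<^sup>2) ^ n) * (\<Prod>n<N. 1 - x * q * (q\<^sup>2) ^ n))
          \<longlonglongrightarrow> qpoch x (q\<^sup>2) * qpoch (x * q) (q\<^sup>2)"
    by (intro tendsto_intros qpoch_tendsto q2)
  also have "(\<lambda>N. (\<Prod>n<N. 1 - x * (q\<^sup>2) ^ n) * (\<Prod>n<N. 1 - x * q * (q\<^sup>2) ^ n))
      = (\<lambda>N. \<Prod>n<2*N. 1 - x * q ^ n)"
  proof
    fix N show "(\<Prod>n<N. 1 - x * (q\<^sup>2) ^ n) * (\<Prod>n<N. 1 - x * q * (q\<^sup>2) ^ n) = (\<Prod>n<2*N. 1 - x * q ^ n)"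
      by (induction N) (simp_all add: mult_ac flip: power_mult)
  qed
  finally show "(\<lambda>N. \<Prod>n<2*N. 1 - x * q ^ n) \<longlonglongrightarrow> qpoch x (q\<^sup>2) * qpoch (x * q) (q\<^sup>2)" .
qed

text \<open>On a closed disc inside \<open>U\<close> the function \<open>x\<close> is bounded and
  |q| attains a maximum below 1, so a geometric series dominates and the partial products converge
  uniformly. Both arguments vary because nome and point will both depend on \<tau>.\<close>

lemma holomorphic_qpoch [holomorphic_intros]:
  assumes x: "x holomorphic_on U" and q: "q holomorphic_on U" and U: "open U"
    and less: "\<And>t. t \<in> U \<Longrightarrow> norm (q t) < 1"
  shows "(\<lambda>t. qpoch (x t) (q t)) holomorphic_on U"
proof (rule holomorphic_uniform_sequence[OF U])
  show "(\<lambda>t. \<Prod>n<N. 1 - x t * q t ^ n) holomorphic_on U" for N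
    by (intro holomorphic_intros x q)
next
  fix t assume "t \<in> U"
  then obtain d where d: "d > 0" "cball t d \<subseteq> U"
    using U open_contains_cball by blast
  let ?K = "cball t d"
  have cx: "continuous_on ?K x" and cq: "continuous_on ?K q"
    using x q d by (meson continuous_on_subset holomorphic_on_imp_continuous_on)+
  have "uniformly_convergent_on ?K (\<lambda>N s. \<Prod>n<N. 1 - x s * q s ^ n)"
  proof (rule uniformly_convergent_on_prod')
    show "continuous_on ?K (\<lambda>s. 1 - x s * q s ^ n)" for n
      by (intro continuous_intros cx cq)
    have "bounded (x ` ?K)"
      by (intro compact_imp_bounded compact_continuous_image cx) auto
    then obtain B where B: "\<And>s. s \<in> ?K \<Longrightarrow> norm (x s) \<le> B"
      unfolding bounded_iff by blast
    have "\<exists>s\<in>?K. \<forall>s'\<in>?K. norm (q s') \<le> norm (q s)"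
      using d by (intro continuous_attains_sup continuous_intros cq) auto
    then obtain s0 where s0: "s0 \<in> ?K" "\<And>s. s \<in> ?K \<Longrightarrow> norm (q s) \<le> norm (q s0)"
      by blast
    have "norm (q s0) < 1"
      using s0 d less by blast
    then have sm: "summable (\<lambda>n. B * norm (q s0) ^ n)"
      by (intro summable_mult summable_geometric) auto
    have "norm (norm (1 - x s * q s ^ n - 1)) \<le> B * norm (q s0) ^ n" if "s \<in> ?K" for n s
    proof -
      have "norm (x s) * norm (q s) ^ n \<le> B * norm (q s0) ^ n"
        using B[OF that] s0(2)[OF that] order_trans[OF norm_ge_zero B[OF that]]
        by (intro mult_mono power_mono) auto
      then show ?thesis
        by (simp add: norm_mult norm_power)
    qed
    then show "uniformly_convergent_on ?K (\<lambda>N s. \<Sum>n<N. norm (1 - x s * q s ^ n - 1))"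
      by (rule Weierstrass_m_test'[OF _ sm])
  qed auto
  then obtain l where l: "uniform_limit ?K (\<lambda>N s. \<Prod>n<N. 1 - x s * q s ^ n) l sequentially"
    by (auto simp: uniformly_convergent_on_def)
  have "l s = qpoch (x s) (q s)" if "s \<in> ?K" for s
  proof (rule LIMSEQ_unique)
    show "(\<lambda>N. \<Prod>n<N. 1 - x s * q s ^ n) \<longlonglongrightarrow> l s"
      using l that by (rule tendsto_uniform_limitI)
    show "(\<lambda>N. \<Prod>n<N. 1 - x s * q s ^ n) \<longlonglongrightarrow> qpoch (x s) (q s)"
      using d less that by (intro qpoch_tendsto) auto
  qed
  then have "uniform_limit ?K (\<lambda>N s. \<Prod>n<N. 1 - x s * q s ^ n) (\<lambda>s. qpoch (x s) (q s)) sequentially"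
    using l by (subst uniform_limit_cong'[where g = "(\<lambda>N s. \<Prod>n<N. 1 - x s * q s ^ n)" and i = l]) auto
  with d show "\<exists>d>0. cball t d \<subseteq> U \<and>
      uniform_limit (cball t d) (\<lambda>N s. \<Prod>n<N. 1 - x s * q s ^ n) (\<lambda>s. qpoch (x s) (q s)) sequentially"
    by blast
qed

section \<open>Entire functions\<close>

text \<open>Near a zero of \<open>g\<close>, f/g is a quotient of difference quotients; it tends to
  f'/g', so the singularity is removable.\<close>

lemma entire_divide_simple_zeros:
  fixes f g :: "complex \<Rightarrow> complex"
  assumes f: "f holomorphic_on UNIV" and g: "g holomorphic_on UNIV"
    and zero: "\<And>z. g z = 0 \<Longrightarrow> f z = 0 \<and> deriv g z \<noteq> 0"
  obtains h where "h holomorphic_on UNIV" "\<And>z. f z = h z * g z"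
proof
  define h where "h = (\<lambda>z. if g z = 0 then deriv f z / deriv g z else f z / g z)"
  show "f z = h z * g z" for z
    using zero by (auto simp: h_def)
  have Df: "(f has_field_derivative deriv f z) (at z)"
    and Dg: "(g has_field_derivative deriv g z) (at z)" for z
    using f g by (auto intro: holomorphic_derivI)
  have "h field_differentiable at z" for z
  proof (cases "g z = 0")
    case False
    have "open {z. g z \<noteq> 0}"
      using holomorphic_on_imp_continuous_on[OF g] by (intro open_Collect_neq) auto
    moreover have "h holomorphic_on {z. g z \<noteq> 0}"
      by (rule holomorphic_transform[of "\<lambda>z. f z / g z"])
        (auto simp: h_def intro!: holomorphic_intros intro: holomorphic_on_subset[OF f] holomorphic_on_subset[OF g])
    ultimately show ?thesis
      using False by (auto intro: holomorphic_on_imp_differentiable_at)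
  next
    case True
    let ?df = "\<lambda>w. (f w - f z) / (w - z)" and ?dg = "\<lambda>w. (g w - g z) / (w - z)"
    have lf: "(?df \<longlongrightarrow> deriv f z) (at z)" and lg: "(?dg \<longlongrightarrow> deriv g z) (at z)"
      using Df Dg by (auto simp: has_field_derivative_iff)
    have "\<forall>\<^sub>F w in at z. ?dg w \<noteq> 0"
      using lg zero[OF True] by (intro tendsto_imp_eventually_ne) auto
    then have ne: "\<forall>\<^sub>F w in at z. g w \<noteq> 0"
      by eventually_elim (use True in auto)
    then obtain d where d: "d > 0" "\<And>w. w \<in> ball z d \<Longrightarrow> w \<noteq> z \<Longrightarrow> g w \<noteq> 0"
      by (auto simp: eventually_at dist_commute)
    have "((\<lambda>w. ?df w / ?dg w) \<longlongrightarrow> deriv f z / deriv g z) (at z)"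
      using zero[OF True] by (intro tendsto_intros lf lg) auto
    moreover have "\<forall>\<^sub>F w in at z. ?df w / ?dg w = h w"
      using ne eventually_neq_at_within[of z z UNIV] by eventually_elim (use True zero in \<open>auto simp: h_def\<close>)
    ultimately have "(h \<longlongrightarrow> h z) (at z)"
      using True by (subst (asm) tendsto_cong) (auto simp: h_def)
    then have "(h \<longlongrightarrow> h z) (at z within ball z d)"
      by (rule tendsto_within_subset) auto
    moreover have "h holomorphic_on ball z d - {z}"
      by (rule holomorphic_transform[of "\<lambda>z. f z / g z"])
        (use d in \<open>auto simp: h_def intro!: holomorphic_intros intro: holomorphic_on_subset[OF f] holomorphic_on_subset[OF g]\<close>)
    ultimately have "h holomorphic_on ball z d"
      using no_isolated_singularity'[of "{z}" h "ball z d"] by auto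
    then show ?thesis
      using d by (intro holomorphic_on_imp_differentiable_at) auto
  qed
  then show "h holomorphic_on UNIV"
    by (simp add: holomorphic_on_def)
qed

text \<open>At a zero of \<open>h\<close>, differentiating both products leaves f h' = g h'. This
  allows cancelling a theta factor even at its zeros.\<close>

lemma entire_mult_cancel_simple_zeros:
  fixes f g h :: "complex \<Rightarrow> complex"
  assumes f: "f holomorphic_on UNIV" and g: "g holomorphic_on UNIV" and h: "h holomorphic_on UNIV"
    and zero: "\<And>z. h z = 0 \<Longrightarrow> deriv h z \<noteq> 0"
    and eq: "\<And>z. f z * h z = g z * h z"
  shows "f z = g z"
proof (cases "h z = 0")
  case True
  have "((\<lambda>w. f w * h w) has_field_derivative (deriv f z * h z + deriv h z * f z)) (at z)"
    using f h by (intro DERIV_mult holomorphic_derivI[of _ UNIV]) auto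
  moreover have "((\<lambda>w. g w * h w) has_field_derivative (deriv g z * h z + deriv h z * g z)) (at z)"
    using g h by (intro DERIV_mult holomorphic_derivI[of _ UNIV]) auto
  moreover have "(\<lambda>w. f w * h w) = (\<lambda>w. g w * h w)"
    using eq by blast
  ultimately have "deriv f z * h z + deriv h z * f z = deriv g z * h z + deriv h z * g z"
    using DERIV_unique by metis
  with True zero show ?thesis
    by simp
next
  case False
  with eq[of z] show ?thesis
    by simp
qed

lemma periodic_int_mult:
  fixes f :: "complex \<Rightarrow> 'a"
  assumes "\<And>z. f (z + p) = f z"
  shows "f (z + of_int m * p) = f z"
proof (induction m rule: int_induct[where k = 0])
  case (step1 i)
  have "f (z + of_int (i + 1) * p) = f (z + of_int i * p + p)"
    by (simp add: algebra_simps)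
  with step1 show ?case
    by (simp add: assms)
next
  case (step2 i)
  have "f (z + of_int (i - 1) * p) = f (z + of_int (i - 1) * p + p)"
    by (rule assms[symmetric])
  also have "\<dots> = f (z + of_int i * p)"
    by (simp add: algebra_simps)
  finally show ?case
    using step2 by simp
qed auto

text \<open>All values occur on a compact period parallelogram, so Liouville's theorem
  applies.\<close>

lemma entire_doubly_periodic_constant:
  assumes f: "f holomorphic_on UNIV" and T: "Im T > 0"
    and per1: "\<And>z. f (z + 1) = f z" and perT: "\<And>z. f (z + T) = f z"
  shows "f z = f w"
proof -
  let ?g = "\<lambda>(x, y). of_real x + of_real y * T"
  let ?K = "?g ` (cbox (0, 0) (1, 1))"
  have "compact ?K"
    by (intro compact_continuous_image compact_cbox) (auto simp: case_prod_unfold intro!: continuous_intros)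
  then have "bounded (f ` ?K)"
    by (intro compact_imp_bounded compact_continuous_image[of ?K] holomorphic_on_imp_continuous_on
        holomorphic_on_subset[OF f]) auto
  moreover have "range f \<subseteq> f ` ?K"
  proof safe
    fix z
    \<comment> \<open>Real coordinates of \<open>z\<close> in the basis 1, T; their fractional parts
      give the representative in the parallelogram.\<close>
    define y where "y = Im z / Im T"
    define x where "x = Re z - y * Re T"
    have z: "z = of_real x + of_real y * T"
      using T by (simp add: complex_eq_iff x_def y_def)
    have "f z = f (of_real (frac x) + of_real (frac y) * T + of_int \<lfloor>y\<rfloor> * T + of_int \<lfloor>x\<rfloor> * 1)"
      by (subst z) (simp add: frac_def algebra_simps)
    also have "\<dots> = f (of_real (frac x) + of_real (frac y) * T + of_int \<lfloor>y\<rfloor> * T)"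
      by (rule periodic_int_mult[of f, OF per1])
    also have "\<dots> = f (of_real (frac x) + of_real (frac y) * T)"
      by (rule periodic_int_mult[of f, OF perT])
    also have "\<dots> = f (?g (frac x, frac y))"
      by simp
    also have "\<dots> \<in> f ` ?K"
      by (intro imageI) (auto simp: cbox_Pair_eq frac_lt_1 less_imp_le)
    finally show "f z \<in> f ` ?K" .
  qed
  ultimately have "f constant_on UNIV"
    using f by (intro Liouville_theorem) (auto intro: bounded_subset)
  then show ?thesis
    by (auto simp: constant_on_def)
qed

section \<open>A theta function\<close>

definition e2pi :: "complex \<Rightarrow> complex" where
  "e2pi z = exp (2 * of_real pi * \<i> * z)"

lemma e2pi_nonzero [simp]: "e2pi z \<noteq> 0"
  by (simp add: e2pi_def)

lemma e2pi_0 [simp]: "e2pi 0 = 1"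
  by (simp add: e2pi_def)

lemma e2pi_add: "e2pi (z + w) = e2pi z * e2pi w"
  by (simp add: e2pi_def ring_distribs exp_add)

lemma e2pi_minus: "e2pi (- z) = inverse (e2pi z)"
  by (simp add: e2pi_def exp_minus)

lemma e2pi_diff: "e2pi (z - w) = e2pi z / e2pi w"
  by (simp add: e2pi_def ring_distribs exp_diff)

lemma e2pi_power: "e2pi z ^ n = e2pi (of_nat n * z)"
  by (simp add: e2pi_def mult_ac flip: exp_of_nat_mult)

lemma e2pi_of_int [simp]: "e2pi (of_int n) = 1"
  by (simp add: e2pi_def exp_eq_1)

lemma e2pi_1 [simp]: "e2pi 1 = 1"
  using e2pi_of_int[of 1] by simp

lemma e2pi_half [simp]: "e2pi (1 / 2) = -1"
  by (simp add: e2pi_def)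

lemma e2pi_eq_1_iff: "e2pi z = 1 \<longleftrightarrow> z \<in> \<int>"
proof
  assume "e2pi z = 1"
  then obtain n :: int where n: "2 * pi * Im z = 0" "2 * pi * Re z = of_int (2 * n) * pi"
    by (auto simp: e2pi_def exp_eq_1)
  then have "z = of_int n"
    by (simp add: complex_eq_iff)
  then show "z \<in> \<int>"
    by simp
qed (auto elim!: Ints_cases)

lemma norm_e2pi_less_1: "Im z > 0 \<Longrightarrow> norm (e2pi z) < 1"
  by (simp add: e2pi_def norm_exp_eq_Re)

lemma holomorphic_e2pi [holomorphic_intros]:
  "f holomorphic_on U \<Longrightarrow> (\<lambda>z. e2pi (f z)) holomorphic_on U"
  unfolding e2pi_def by (intro holomorphic_intros)

definition period_lattice :: "complex \<Rightarrow> complex set" where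
  "period_lattice T = {of_int m * T + of_int n | m n. True}"

text \<open>Up to a factor independent of \<open>z\<close>, this is Jacobi's \<open>\<theta>\<^sub>1\<close>; the factor \<open>e2pi (- z / 2)\<close> makes
  it an odd function of \<open>z\<close>.\<close>
definition theta :: "complex \<Rightarrow> complex \<Rightarrow> complex" where
  "theta T z = e2pi (- z / 2) * qpoch (e2pi z) (e2pi T) * qpoch (e2pi (T - z)) (e2pi T)"

text \<open>Splitting off the first factor exposes the oddness and the simple zero at 0.\<close>

lemma theta_alt:
  assumes "Im T > 0"
  shows "theta T z = (e2pi (- z / 2) - e2pi (z / 2)) *
    qpoch (e2pi (T + z)) (e2pi T) * qpoch (e2pi (T - z)) (e2pi T)"
proof -
  have "e2pi (- z / 2) * e2pi z = e2pi (z / 2)"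
    by (simp flip: e2pi_add)
  then show ?thesis
    unfolding theta_def qpoch_rec[OF norm_e2pi_less_1[OF assms], of "e2pi z"]
    by (simp add: algebra_simps flip: e2pi_add)
qed

lemma theta_minus:
  assumes "Im T > 0"
  shows "theta T (- z) = - theta T z"
  by (simp add: theta_alt[OF assms] algebra_simps)

lemma theta_0 [simp]: "Im T > 0 \<Longrightarrow> theta T 0 = 0"
  by (simp add: theta_alt)

lemma theta_add_1: "theta T (z + 1) = - theta T z"
proof -
  have "e2pi (- (z + 1) / 2) = e2pi (- z / 2 - 1 / 2)"
    by (rule arg_cong[where f = e2pi]) (simp add: field_simps)
  also have "\<dots> = - e2pi (- z / 2)"
    unfolding e2pi_diff by simp
  finally show ?thesis
    unfolding theta_def by (simp add: e2pi_add e2pi_diff)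
qed

lemma theta_add_period:
  assumes "Im T > 0"
  shows "theta T (z + T) = - e2pi (- T / 2 - z) * theta T z"
proof -
  \<comment> \<open>The shift removes the leading factor of the first product and puts a new one in
    front of the second; the multiplier is their ratio times the change of the exponential
    prefactor.\<close>
  have "e2pi (- (z + T) / 2) * (1 - e2pi (- z)) = - e2pi (- T / 2 - z) * (e2pi (- z / 2) - e2pi (z / 2))"
    by (simp add: algebra_simps diff_divide_distrib flip: e2pi_add)
  moreover have "theta T (z + T) = e2pi (- (z + T) / 2) * (1 - e2pi (- z)) *
      (qpoch (e2pi (T + z)) (e2pi T) * qpoch (e2pi (T - z)) (e2pi T))"
    using qpoch_rec[OF norm_e2pi_less_1[OF assms], of "e2pi (- z)"]
    by (simp add: theta_def add.commute mult_ac flip: e2pi_add)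
  ultimately show ?thesis
    by (simp add: theta_alt[OF assms, of z])
qed

lemma theta_add_of_int: "theta T (z + of_int n) = (- 1) powi n * theta T z"
proof (induction n rule: int_induct[where k = 0])
  case (step1 i)
  then show ?case
    using theta_add_1[of T "z + of_int i"] by (simp add: power_int_add algebra_simps)
next
  case (step2 i)
  then show ?case
    using theta_add_1[of T "z + of_int (i - 1)"] by (simp add: power_int_diff algebra_simps)
qed auto

lemma theta_add_int_mult_period:
  assumes "Im T > 0"
  shows "theta T (z + of_int m * T) = (- 1) powi m * e2pi (- (of_int m)\<^sup>2 * T / 2 - of_int m * z) * theta T z"
proof (induction m rule: int_induct[where k = 0])
  case (step1 i)
  have "theta T (z + of_int (i + 1) * T) = theta T ((z + of_int i * T) + T)"
    by (simp add: algebra_simps)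
  also have "\<dots> = - ((- 1) powi i) * (e2pi (- T / 2 - (z + of_int i * T)) *
      e2pi (- (of_int i)\<^sup>2 * T / 2 - of_int i * z)) * theta T z"
    by (simp add: theta_add_period[OF assms] step1)
  also have "e2pi (- T / 2 - (z + of_int i * T)) * e2pi (- (of_int i)\<^sup>2 * T / 2 - of_int i * z)
      = e2pi (- (of_int (i + 1))\<^sup>2 * T / 2 - of_int (i + 1) * z)"
    unfolding e2pi_add[symmetric] by (rule arg_cong[where f = e2pi]) (simp add: field_simps power2_eq_square)
  finally show ?case
    by (simp add: power_int_add)
next
  case (step2 i)
  have "(- 1) powi i * e2pi (- (of_int i)\<^sup>2 * T / 2 - of_int i * z) * theta T z
      = theta T ((z + of_int (i - 1) * T) + T)"
    using step2 by (simp add: algebra_simps)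
  also have "\<dots> = - e2pi (- T / 2 - (z + of_int (i - 1) * T)) * theta T (z + of_int (i - 1) * T)"
    by (rule theta_add_period[OF assms])
  finally have "theta T (z + of_int (i - 1) * T) = - ((- 1) powi i) *
      (e2pi (- (of_int i)\<^sup>2 * T / 2 - of_int i * z) / e2pi (- T / 2 - (z + of_int (i - 1) * T))) * theta T z"
    by (simp add: field_simps)
  also have "e2pi (- (of_int i)\<^sup>2 * T / 2 - of_int i * z) / e2pi (- T / 2 - (z + of_int (i - 1) * T))
      = e2pi (- (of_int (i - 1))\<^sup>2 * T / 2 - of_int (i - 1) * z)"
    unfolding e2pi_diff[symmetric] by (rule arg_cong[where f = e2pi]) (simp add: field_simps power2_eq_square)
  finally show ?case
    by (simp add: power_int_diff)
qed auto

lemma theta_add_lattice: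
  assumes "Im T > 0"
  shows "theta T (z + of_int m * T + of_int n) =
    (- 1) powi (m + n) * e2pi (- (of_int m)\<^sup>2 * T / 2 - of_int m * z) * theta T z"
  by (simp add: theta_add_of_int theta_add_int_mult_period[OF assms] power_int_add)

lemma theta_eq_0_iff:
  assumes "Im T > 0"
  shows "theta T z = 0 \<longleftrightarrow> z \<in> period_lattice T"
proof
  assume "theta T z = 0"
  then consider n where "e2pi (z + of_nat n * T) = 1" | n where "e2pi (T - z + of_nat n * T) = 1"
    unfolding theta_def by (auto simp: qpoch_eq_0_iff[OF norm_e2pi_less_1[OF assms]] e2pi_power e2pi_add)
  then show "z \<in> period_lattice T"
  proof cases
    case 1
    then obtain k where "z + of_nat n * T = of_int k"
      by (auto simp: e2pi_eq_1_iff elim: Ints_cases)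
    then have "z = of_int (- int n) * T + of_int k"
      by (simp add: algebra_simps)
    then show ?thesis
      unfolding period_lattice_def by blast
  next
    case 2
    then obtain k where "T - z + of_nat n * T = of_int k"
      by (auto simp: e2pi_eq_1_iff elim: Ints_cases)
    then have "z = of_int (int n + 1) * T + of_int (- k)"
      by (simp add: algebra_simps)
    then show ?thesis
      unfolding period_lattice_def by blast
  qed
next
  assume "z \<in> period_lattice T"
  then obtain m n where "z = 0 + of_int m * T + of_int n"
    by (auto simp: period_lattice_def)
  then show "theta T z = 0"
    using theta_add_lattice[OF assms, of 0] assms by simp
qed

lemma holomorphic_theta:
  assumes "f holomorphic_on U" "g holomorphic_on U" "open U" "\<And>t. t \<in> U \<Longrightarrow> Im (f t) > 0"
  shows "(\<lambda>t. theta (f t) (g t)) holomorphic_on U"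
  unfolding theta_def using assms by (intro holomorphic_intros norm_e2pi_less_1) auto

lemma theta_entire:
  assumes "Im T > 0"
  shows "theta T holomorphic_on UNIV"
  using holomorphic_theta[of "\<lambda>_. T" UNIV "\<lambda>z. z"] assms by auto

text \<open>At 0 the odd exponential factor has derivative -2 pi i and the remaining product
  \<open>G\<close> does not vanish. Quasi-periodicity carries this to every other lattice
  point.\<close>

lemma deriv_theta_nonzero:
  assumes T: "Im T > 0" and z: "theta T z = 0"
  shows "deriv (theta T) z \<noteq> 0"
proof -
  let ?q = "e2pi T"
  have q: "norm ?q < 1"
    using T by (rule norm_e2pi_less_1)
  define G where "G = (\<lambda>z. qpoch (e2pi (T + z)) ?q * qpoch (e2pi (T - z)) ?q)"
  have "G holomorphic_on UNIV"
    unfolding G_def using q by (intro holomorphic_intros) auto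
  then have "(G has_field_derivative deriv G 0) (at 0)"
    by (auto intro: holomorphic_derivI)
  moreover have "((\<lambda>z. e2pi (- z / 2) - e2pi (z / 2)) has_field_derivative - (2 * of_real pi * \<i>)) (at 0)"
    unfolding e2pi_def by (auto intro!: derivative_eq_intros)
  ultimately have "((\<lambda>z. (e2pi (- z / 2) - e2pi (z / 2)) * G z) has_field_derivative
       - (2 * of_real pi * \<i>) * G 0 + deriv G 0 * (e2pi (- 0 / 2) - e2pi (0 / 2))) (at 0)"
    by (intro DERIV_mult)
  moreover have "(\<lambda>z. (e2pi (- z / 2) - e2pi (z / 2)) * G z) = theta T"
    by (auto simp: fun_eq_iff theta_alt[OF T] G_def)
  ultimately have D0: "(theta T has_field_derivative - (2 * of_real pi * \<i>) * G 0) (at 0)"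
    by simp
  have "norm (?q ^ Suc n) < 1" for n
    using q by (subst norm_power, subst power_Suc_less_one) auto
  then have "?q ^ Suc n \<noteq> 1" for n
    by (metis less_irrefl norm_one)
  then have "G 0 \<noteq> 0"
    using q by (auto simp: G_def qpoch_eq_0_iff)
  obtain m n where mn: "z = of_int m * T + of_int n"
    using z by (auto simp: theta_eq_0_iff[OF T] period_lattice_def)
  \<comment> \<open>The multiplier of the translation by the lattice point \<open>z\<close>, as a
    nowhere vanishing function of w.\<close>
  define c where "c = (\<lambda>w. (- 1) powi (m + n) * e2pi (- (of_int m)\<^sup>2 * T / 2 - of_int m * (w - z)))"
  have "c holomorphic_on UNIV"
    unfolding c_def by (intro holomorphic_intros)
  then have "(c has_field_derivative deriv c z) (at z)"
    by (auto intro: holomorphic_derivI)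
  moreover have "((\<lambda>w. theta T (w - z)) has_field_derivative - (2 * of_real pi * \<i>) * G 0 * 1) (at z)"
    by (rule DERIV_chain2[of "theta T"]) (use D0 in \<open>auto intro!: derivative_eq_intros\<close>)
  ultimately have "((\<lambda>w. c w * theta T (w - z)) has_field_derivative
      deriv c z * theta T (z - z) + - (2 * of_real pi * \<i>) * G 0 * 1 * c z) (at z)"
    by (rule DERIV_mult)
  moreover have "(\<lambda>w. c w * theta T (w - z)) = theta T"
  proof
    fix w
    show "c w * theta T (w - z) = theta T w"
      using theta_add_lattice[OF T, of "w - z" m n] by (simp add: c_def mn)
  qed
  ultimately have "deriv (theta T) z = - (2 * of_real pi * \<i>) * G 0 * c z"
    using T by (auto simp: DERIV_imp_deriv)
  then show ?thesis
    using \<open>G 0 \<noteq> 0\<close> by (simp add: c_def power_int_eq_0_iff)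
qed

section \<open>Differences of Weierstrass values\<close>

text \<open>In the product of the two multipliers the signs square to 1 and \<open>v\<close>
  cancels. Hence all such pairs, for every \<open>v\<close>, share one multiplier.\<close>

lemma theta_pair_add_lattice:
  assumes "Im T > 0"
  shows "theta T (z + of_int m * T + of_int n + v) * theta T (z + of_int m * T + of_int n - v) =
    e2pi (- (of_int m)\<^sup>2 * T - 2 * of_int m * z) * (theta T (z + v) * theta T (z - v))"
proof -
  have "theta T (z + of_int m * T + of_int n + v) * theta T (z + of_int m * T + of_int n - v) =
      theta T ((z + v) + of_int m * T + of_int n) * theta T ((z - v) + of_int m * T + of_int n)"
    by (simp add: algebra_simps)
  also have "\<dots> = ((- 1) powi (m + n) * (- 1) powi (m + n)) *
      (e2pi (- (of_int m)\<^sup>2 * T / 2 - of_int m * (z + v)) * e2pi (- (of_int m)\<^sup>2 * T / 2 - of_int m * (z - v))) *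
      (theta T (z + v) * theta T (z - v))"
    unfolding theta_add_lattice[OF assms] by (simp only: mult_ac)
  also have "(- 1 :: complex) powi (m + n) * (- 1) powi (m + n) = 1"
    by (simp flip: power_int_mult_distrib)
  also have "e2pi (- (of_int m)\<^sup>2 * T / 2 - of_int m * (z + v)) * e2pi (- (of_int m)\<^sup>2 * T / 2 - of_int m * (z - v))
      = e2pi (- (of_int m)\<^sup>2 * T - 2 * of_int m * z)"
    by (simp add: algebra_simps flip: e2pi_add)
  finally show ?thesis
    by simp
qed

lemma period_lattice_0 [simp]: "0 \<in> period_lattice T"
  by (force simp: period_lattice_def intro: exI[of _ 0])

lemma period_lattice_diff:
  assumes "z \<in> period_lattice T" "w \<in> period_lattice T"
  shows "z - w \<in> period_lattice T"
proof -
  from assms obtain m n m' n' where "z = of_int m * T + of_int n" "w = of_int m' * T + of_int n'"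
    by (auto simp: period_lattice_def)
  then have "z - w = of_int (m - m') * T + of_int (n - n')"
    by (simp add: algebra_simps)
  then show ?thesis
    unfolding period_lattice_def by blast
qed

lemma period_lattice_uminus: "z \<in> period_lattice T \<Longrightarrow> - z \<in> period_lattice T"
  using period_lattice_diff[OF period_lattice_0] by force

lemma period_lattice_add:
  "z \<in> period_lattice T \<Longrightarrow> w \<in> period_lattice T \<Longrightarrow> z + w \<in> period_lattice T"
  using period_lattice_diff[of z T "- w"] period_lattice_uminus by simp

text \<open>As functions of \<open>z = a\<close>, the left-hand side and \<open>theta T (z + b) * theta T (z - b)\<close> have
  the same multipliers, and the former vanishes where the latter does; the quotient is therefore
  constant, and it vanishes at \<open>0\<close>.\<close>
lemma theta_three_term:
  assumes T: "Im T > 0" and b: "2 * b \<notin> period_lattice T"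
  shows "theta T (a + b) * theta T (a - b) * (theta T c)\<^sup>2 + theta T (b + c) * theta T (b - c) * (theta T a)\<^sup>2
    = theta T (a + c) * theta T (a - c) * (theta T b)\<^sup>2"
proof -
  let ?S = "theta T"
  \<comment> \<open>Note that \<open>D 0 z\<close> is the square of \<open>theta T z\<close>, so all
    three terms of \<open>N\<close> have the multiplier of a pair.\<close>
  define D where "D = (\<lambda>v z. ?S (z + v) * ?S (z - v))"
  define N where "N = (\<lambda>z. D b z * (?S c)\<^sup>2 + D c b * D 0 z - D c z * (?S b)\<^sup>2)"
  have hS: "(\<lambda>z. ?S (f z)) holomorphic_on UNIV" if "f holomorphic_on UNIV" for f
    using holomorphic_theta[of "\<lambda>_. T" UNIV f] that T by auto
  have hD: "D v holomorphic_on UNIV" for v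
    unfolding D_def by (intro holomorphic_intros hS)
  have hN: "N holomorphic_on UNIV"
    unfolding N_def by (intro holomorphic_intros hD)
  have D_lat: "D v (z + of_int m * T + of_int n) = e2pi (- (of_int m)\<^sup>2 * T - 2 * of_int m * z) * D v z" for v z m n
    unfolding D_def by (rule theta_pair_add_lattice[OF T])
  have N_lat: "N (z + of_int m * T + of_int n) = e2pi (- (of_int m)\<^sup>2 * T - 2 * of_int m * z) * N z" for z m n
    unfolding N_def D_lat by (simp add: algebra_simps)
  have b0: "b \<notin> period_lattice T"
    using b period_lattice_diff[OF _ period_lattice_diff[OF period_lattice_0, of b T], of b] by auto
  \<comment> \<open>At b the first term contains \<open>theta T 0\<close>, and the other two cancel;
    oddness gives the same at -b.\<close>
  have N_b: "N b = 0" and N_mb: "N (- b) = 0"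
    using theta_minus[OF T, of "b + c"] theta_minus[OF T, of "b - c"] T
    by (auto simp: N_def D_def power2_eq_square theta_minus[OF T, of b])
  have N_0: "N 0 = 0"
    using T by (auto simp: N_def D_def theta_minus power2_eq_square)
  have zero: "N z = 0 \<and> deriv (D b) z \<noteq> 0" if "D b z = 0" for z
  proof
    from that consider "z + b \<in> period_lattice T" | "z - b \<in> period_lattice T"
      by (auto simp: D_def theta_eq_0_iff[OF T])
    then show "N z = 0"
    proof cases
      case 1
      then obtain m n where "z + b = of_int m * T + of_int n"
        by (auto simp: period_lattice_def)
      then have z: "z = - b + of_int m * T + of_int n"
        by (simp add: algebra_simps)
      show ?thesis
        unfolding z N_lat by (simp add: N_mb)
    next
      case 2
      then obtain m n where "z - b = of_int m * T + of_int n"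
        by (auto simp: period_lattice_def)
      then have z: "z = b + of_int m * T + of_int n"
        by (simp add: algebra_simps)
      show ?thesis
        unfolding z N_lat by (simp add: N_b)
    qed
    have DS: "(?S has_field_derivative deriv ?S w) (at w)" for w
      using theta_entire[OF T] by (auto intro: holomorphic_derivI)
    have "((\<lambda>z. ?S (z + b)) has_field_derivative deriv ?S (z + b) * 1) (at z)"
      "((\<lambda>z. ?S (z - b)) has_field_derivative deriv ?S (z - b) * 1) (at z)"
      by (rule DERIV_chain2[OF DS]; auto intro!: derivative_eq_intros)+
    then have "(D b has_field_derivative (deriv ?S (z + b) * ?S (z - b) + deriv ?S (z - b) * ?S (z + b))) (at z)"
      unfolding D_def using DERIV_mult by fastforce
    then have eq: "deriv (D b) z = deriv ?S (z + b) * ?S (z - b) + deriv ?S (z - b) * ?S (z + b)"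
      by (rule DERIV_imp_deriv)
    \<comment> \<open>If both factors vanished, the difference 2b of their arguments would be a
      lattice point. So the zeros of \<open>D b\<close> are simple.\<close>
    have "\<not> (?S (z + b) = 0 \<and> ?S (z - b) = 0)"
      using b period_lattice_diff[of "z + b" T "z - b"] by (auto simp: theta_eq_0_iff[OF T])
    with that show "deriv (D b) z \<noteq> 0"
      using deriv_theta_nonzero[OF T] unfolding eq by (auto simp: D_def)
  qed
  obtain h where h: "h holomorphic_on UNIV" and N_eq: "\<And>z. N z = h z * D b z"
    using entire_divide_simple_zeros[OF hN hD zero] by blast
  have per: "h (z + of_int m * T + of_int n) = h z" for z m n
  proof (rule entire_mult_cancel_simple_zeros[where f = "\<lambda>z. h (z + of_int m * T + of_int n)" and g = h and h = "D b"])
    show "(\<lambda>z. h (z + of_int m * T + of_int n)) holomorphic_on UNIV"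
      by (rule holomorphic_on_compose_gen[OF _ h, unfolded o_def]) (auto intro!: holomorphic_intros)
    show "h (z + of_int m * T + of_int n) * D b z = h z * D b z" for z
      using N_eq[of "z + of_int m * T + of_int n"] N_eq[of z] unfolding N_lat D_lat by auto
  qed (use h hD zero in auto)
  have "h a = h 0"
    by (rule entire_doubly_periodic_constant[OF h T]) (use per[of _ 0 1] per[of _ 1 0] in auto)
  moreover have "D b 0 \<noteq> 0"
    using b0 by (auto simp: D_def theta_minus[OF T] theta_eq_0_iff[OF T])
  ultimately have "N a = 0"
    using N_eq[of 0] N_eq[of a] N_0 by simp
  then show ?thesis
    by (simp add: N_def D_def power2_eq_square)
qed

text \<open>Up to a factor that depends only on \<open>T\<close>, this is the difference
  \<open>\<wp>(a) - \<wp>(b)\<close> of two values of the Weierstrass function of the lattice \<open>\<int>T + \<int>\<close>.\<close>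
definition wp_diff :: "complex \<Rightarrow> complex \<Rightarrow> complex \<Rightarrow> complex" where
  "wp_diff T a b = theta T (a + b) * theta T (a - b) / ((theta T a)\<^sup>2 * (theta T b)\<^sup>2)"

lemma wp_diff_swap: "Im T > 0 \<Longrightarrow> wp_diff T b a = - wp_diff T a b"
  using theta_minus[of T "a - b"] by (simp add: wp_diff_def add.commute)

text \<open>This is \<open>theta_three_term\<close> divided by the squares of the theta values at a,
  b and c.\<close>

lemma wp_diff_add:
  assumes T: "Im T > 0" and "a \<notin> period_lattice T" "c \<notin> period_lattice T" "2 * b \<notin> period_lattice T"
  shows "wp_diff T a b + wp_diff T b c = wp_diff T a c"
proof -
  have "b \<notin> period_lattice T"
    using assms period_lattice_diff[OF _ period_lattice_diff[OF period_lattice_0, of b T], of b] by auto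
  with assms theta_three_term[OF T assms(4), of a c] show ?thesis
    by (simp add: wp_diff_def theta_eq_0_iff[OF T] field_simps)
qed

lemma wp_diff_minus_left: "Im T > 0 \<Longrightarrow> wp_diff T (- a) b = wp_diff T a b"
  using theta_minus[of T "a + b"] theta_minus[of T "a - b"] theta_minus[of T a]
  by (simp add: wp_diff_def add.commute)

text \<open>Numerator and denominator acquire the same multiplier: the pair with v = b against the
  pair with v = 0.\<close>

lemma wp_diff_add_lattice_left:
  assumes T: "Im T > 0"
  shows "wp_diff T (a + of_int m * T + of_int n) b = wp_diff T a b"
  using theta_pair_add_lattice[OF T, of a m n b] theta_pair_add_lattice[OF T, of a m n 0]
  by (simp add: wp_diff_def power2_eq_square)

lemma wp_diff_cong_left:
  assumes T: "Im T > 0" and "a - a' \<in> period_lattice T \<or> a + a' \<in> period_lattice T"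
  shows "wp_diff T a b = wp_diff T a' b"
proof -
  from assms obtain m n where "a = a' + of_int m * T + of_int n \<or> a = - a' + of_int m * T + of_int n"
    by (auto simp: period_lattice_def algebra_simps)
  then show ?thesis
    by (metis T wp_diff_add_lattice_left wp_diff_minus_left)
qed

lemma wp_diff_cong:
  assumes T: "Im T > 0" and "a - a' \<in> period_lattice T \<or> a + a' \<in> period_lattice T"
    and "b - b' \<in> period_lattice T \<or> b + b' \<in> period_lattice T"
  shows "wp_diff T a b = wp_diff T a' b'"
  using wp_diff_cong_left[OF T assms(2), of b] wp_diff_cong_left[OF T assms(3), of a']
    wp_diff_swap[OF T] by metis

section \<open>Modular transformation of the differences\<close>

lemma Im_moebius_pos:
  fixes a b c d :: int
  assumes T: "Im T > 0" and det: "a * d - b * c = 1"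
  shows "Im ((of_int a * T + of_int b) / (of_int c * T + of_int d)) > 0" "of_int c * T + of_int d \<noteq> 0"
proof -
  let ?J = "of_int c * T + of_int d"
  show J: "?J \<noteq> 0"
  proof
    assume "?J = 0"
    then have "of_int c * Im T = 0" "of_int c * Re T + of_int d = 0"
      by (auto simp: complex_eq_iff)
    with T have "c = 0" "d = 0"
      by auto
    with det show False
      by simp
  qed
  have "Im ((of_int a * T + of_int b) / ?J) = Im ((of_int a * T + of_int b) * cnj ?J) / (norm ?J)\<^sup>2"
    by (subst complex_div_cnj) (metis Im_divide_of_real of_real_power)
  also have "Im ((of_int a * T + of_int b) * cnj ?J) = of_int (a * d - b * c) * Im T"
    by (simp add: algebra_simps)
  finally show "Im ((of_int a * T + of_int b) / ?J) > 0"
    using J T det by (simp add: power2_eq_square)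
qed

text \<open>The quotient \<open>\<psi>\<close> of the two theta functions is entire without zeros and satisfies
  \<open>\<psi> (z + \<omega>) = exp (\<alpha> + \<beta> z) \<psi> z\<close> for lattice vectors \<open>\<omega>\<close>. So
  \<open>\<psi> (z + v) \<psi> (z - v) / (\<psi> z)\<^sup>2\<close> is elliptic in \<open>z\<close> without poles, hence constant.\<close>
lemma wp_diff_moebius:
  fixes a b c d :: int
  assumes T: "Im T > 0" and det: "a * d - b * c = 1"
  defines "J \<equiv> of_int c * T + of_int d"
  defines "T' \<equiv> (of_int a * T + of_int b) / J"
  obtains \<kappa> where "\<kappa> \<noteq> 0" "\<And>z v. wp_diff T' (z / J) (v / J) = \<kappa> * wp_diff T z v"
proof -
  have T': "Im T' > 0" and J: "J \<noteq> 0"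
    using Im_moebius_pos[OF T det] by (simp_all add: J_def T'_def)
  have det': "of_int a * of_int d - of_int b * of_int c = (1 :: complex)"
    using det by (metis of_int_1 of_int_diff of_int_mult)
  \<comment> \<open>Together with \<open>invT\<close> this writes the basis of the scaled lattice in
    terms of T' and 1, using the inverse matrix; the two lattices agree up to division by J.\<close>
  have inv1: "1 / J = of_int (- c) * T' + of_int a"
  proof -
    have "of_int (- c) * T' + of_int a = (of_int a * J - of_int c * (of_int a * T + of_int b)) / J"
      using J by (simp add: T'_def field_simps)
    also have "of_int a * J - of_int c * (of_int a * T + of_int b) = of_int a * of_int d - of_int b * of_int c"
      by (simp add: J_def algebra_simps)
    finally show ?thesis
      using det' by simp
  qed
  have invT: "T / J = of_int d * T' + of_int (- b)"
  proof -
    have "of_int d * T' + of_int (- b) = (of_int d * (of_int a * T + of_int b) - of_int b * J) / J"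
      using J by (simp add: T'_def field_simps)
    also have "of_int d * (of_int a * T + of_int b) - of_int b * J = (of_int a * of_int d - of_int b * of_int c) * T"
      by (simp add: J_def algebra_simps)
    finally show ?thesis
      using det' by simp
  qed
  define f where "f = (\<lambda>z. theta T' (z / J))"
  define g where "g = theta T"
  have f: "f holomorphic_on UNIV"
    unfolding f_def using T' J by (intro holomorphic_theta holomorphic_intros) auto
  have g: "g holomorphic_on UNIV"
    unfolding g_def by (rule theta_entire[OF T])
  have zeros: "f z = 0 \<longleftrightarrow> g z = 0" for z
  proof
    assume "f z = 0"
    then obtain m n where "z / J = of_int m * T' + of_int n"
      by (auto simp: f_def theta_eq_0_iff[OF T'] period_lattice_def)
    then have "z = of_int m * (of_int a * T + of_int b) + of_int n * J"
      using J by (simp add: T'_def field_simps)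
    also have "\<dots> = of_int (m * a + n * c) * T + of_int (m * b + n * d)"
      by (simp add: J_def algebra_simps)
    finally show "g z = 0"
      unfolding g_def theta_eq_0_iff[OF T] period_lattice_def by blast
  next
    assume "g z = 0"
    then obtain m n where "z = of_int m * T + of_int n"
      by (auto simp: g_def theta_eq_0_iff[OF T] period_lattice_def)
    then have "z / J = of_int m * (T / J) + of_int n * (1 / J)"
      by (simp add: add_divide_distrib)
    also have "\<dots> = of_int (m * d - n * c) * T' + of_int (n * a - m * b)"
      unfolding inv1 invT by (simp add: algebra_simps)
    finally show "f z = 0"
      unfolding f_def theta_eq_0_iff[OF T'] period_lattice_def by blast
  qed
  have g': "deriv g z \<noteq> 0" if "g z = 0" for z
    using deriv_theta_nonzero[OF T] that unfolding g_def .
  have f': "deriv f z \<noteq> 0" if "f z = 0" for z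
  proof -
    have "(theta T' has_field_derivative deriv (theta T') (z / J)) (at (z / J))"
      using theta_entire[OF T'] by (auto intro: holomorphic_derivI)
    then have "(f has_field_derivative deriv (theta T') (z / J) * (1 / J)) (at z)"
      unfolding f_def by (rule DERIV_chain2) (use J in \<open>auto intro!: derivative_eq_intros\<close>)
    then have "deriv f z = deriv (theta T') (z / J) * (1 / J)"
      by (rule DERIV_imp_deriv)
    then show ?thesis
      using J that deriv_theta_nonzero[OF T'] by (simp add: f_def)
  qed
  obtain \<psi> where \<psi>: "\<psi> holomorphic_on UNIV" and f_eq: "\<And>z. f z = \<psi> z * g z"
    using entire_divide_simple_zeros[OF f g] zeros g' by blast
  \<comment> \<open>A zero of \<psi> would be a zero of \<open>g\<close> as well and hence a
    multiple zero of \<open>f\<close>, whose zeros are simple.\<close>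
  have \<psi>0: "\<psi> z \<noteq> 0" for z
  proof
    assume 0: "\<psi> z = 0"
    then have "f z = 0" "g z = 0"
      using f_eq[of z] zeros[of z] by auto
    have "((\<lambda>w. \<psi> w * g w) has_field_derivative (deriv \<psi> z * g z + deriv g z * \<psi> z)) (at z)"
      by (intro DERIV_mult holomorphic_derivI[OF \<psi>] holomorphic_derivI[OF g]) auto
    moreover have "f = (\<lambda>w. \<psi> w * g w)"
      using f_eq by blast
    ultimately have "deriv f z = deriv \<psi> z * g z + deriv g z * \<psi> z"
      by (metis DERIV_imp_deriv)
    with 0 \<open>g z = 0\<close> f'[OF \<open>f z = 0\<close>] show False
      by simp
  qed
  have holshift: "(\<lambda>z. \<psi> (k z)) holomorphic_on UNIV" if "k holomorphic_on UNIV" for k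
    using holomorphic_on_compose_gen[OF that \<psi>] by (simp add: o_def)
  \<comment> \<open>A quotient of two odd functions is even.\<close>
  have \<psi>_minus: "\<psi> (- z) = \<psi> z" for z
  proof (rule entire_mult_cancel_simple_zeros[where f = "\<lambda>z. \<psi> (- z)" and g = \<psi> and h = g])
    show "\<psi> (- z) * g z = \<psi> z * g z" for z
      using f_eq[of z] f_eq[of "- z"] theta_minus[OF T, of z] theta_minus[OF T', of "z / J"]
      by (auto simp: f_def g_def)
  qed (auto intro!: holshift \<psi> g g' holomorphic_intros)
  have \<psi>_quasi: "\<exists>s \<alpha> \<beta>. \<forall>z. \<psi> (z + w) = s * e2pi (\<alpha> + \<beta> * z) * \<psi> z"
    if w: "w = of_int m * T + of_int n" and w': "w / J = of_int m' * T' + of_int n'" for w m n m' n'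
  proof -
    \<comment> \<open>The sign, constant term and slope come from dividing the multiplier for T' by
      the one for T.\<close>
    define s where "s = (- 1 :: complex) powi (m' + n') / (- 1) powi (m + n)"
    define \<alpha> where "\<alpha> = - (of_int m')\<^sup>2 * T' / 2 + (of_int m)\<^sup>2 * T / 2"
    define \<beta> where "\<beta> = - of_int m' / J + of_int m"
    have "\<psi> (z + w) = s * e2pi (\<alpha> + \<beta> * z) * \<psi> z" for z
    proof (rule entire_mult_cancel_simple_zeros[where f = "\<lambda>z. \<psi> (z + w)" and g = "\<lambda>z. s * e2pi (\<alpha> + \<beta> * z) * \<psi> z" and h = g])
      fix z
      let ?s = "(- 1 :: complex) powi (m + n)" and ?s' = "(- 1 :: complex) powi (m' + n')"
      let ?e = "e2pi (- (of_int m)\<^sup>2 * T / 2 - of_int m * z)"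
        and ?e' = "e2pi (- (of_int m')\<^sup>2 * T' / 2 - of_int m' * (z / J))"
      have "g (z + w) = ?s * ?e * g z"
        unfolding g_def w by (subst theta_add_lattice[OF T, symmetric]) (simp add: add_ac)
      moreover have "f (z + w) = ?s' * ?e' * f z"
        unfolding f_def add_divide_distrib w'
        by (subst theta_add_lattice[OF T', symmetric]) (simp add: add_ac)
      ultimately have "\<psi> (z + w) * (?s * ?e * g z) = ?s' * ?e' * (\<psi> z * g z)"
        using f_eq[of "z + w"] f_eq[of z] by simp
      then have "\<psi> (z + w) * g z = s * (?e' / ?e) * (\<psi> z * g z)"
        by (simp add: s_def field_simps)
      also have "?e' / ?e = e2pi (\<alpha> + \<beta> * z)"
        unfolding e2pi_diff[symmetric] \<alpha>_def \<beta>_def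
        by (rule arg_cong[where f = e2pi]) (use J in \<open>simp add: field_simps\<close>)
      finally show "\<psi> (z + w) * g z = s * e2pi (\<alpha> + \<beta> * z) * \<psi> z * g z"
        by (simp add: mult_ac)
    qed (auto intro!: holshift \<psi> g g' holomorphic_intros)
    then show ?thesis
      by blast
  qed
  have \<psi>_pair: "\<psi> (z + v) * \<psi> (z - v) = (\<psi> z)\<^sup>2 * (\<psi> v)\<^sup>2 / (\<psi> 0)\<^sup>2" for z v
  proof -
    define H where "H = (\<lambda>z. \<psi> (z + v) * \<psi> (z - v) / (\<psi> z)\<^sup>2)"
    have "H holomorphic_on UNIV"
      unfolding H_def using \<psi>0 by (auto intro!: holshift holomorphic_intros)
    have per: "H (z + w) = H z" if quasi: "\<forall>z. \<psi> (z + w) = s * e2pi (\<alpha> + \<beta> * z) * \<psi> z" for z w s \<alpha> \<beta>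
    proof -
      have "s \<noteq> 0"
        using quasi[rule_format, of 0] \<psi>0[of w] by auto
      have *: "\<psi> (z + w + v) = s * e2pi (\<alpha> + \<beta> * (z + v)) * \<psi> (z + v)"
        "\<psi> (z + w - v) = s * e2pi (\<alpha> + \<beta> * (z - v)) * \<psi> (z - v)"
        using quasi[rule_format, of "z + v"] quasi[rule_format, of "z - v"] by (simp_all add: algebra_simps)
      \<comment> \<open>The exponent is affine in z, so the contributions of v and -v
        cancel.\<close>
      have "e2pi (\<alpha> + \<beta> * (z + v)) * e2pi (\<alpha> + \<beta> * (z - v)) = (e2pi (\<alpha> + \<beta> * z))\<^sup>2"
        unfolding power2_eq_square e2pi_add[symmetric]
        by (rule arg_cong[where f = e2pi]) (simp add: algebra_simps)
      then have "\<psi> (z + w + v) * \<psi> (z + w - v) = (s * e2pi (\<alpha> + \<beta> * z))\<^sup>2 * (\<psi> (z + v) * \<psi> (z - v))"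
        unfolding * by (simp add: power2_eq_square mult_ac)
      then show ?thesis
        using \<open>s \<noteq> 0\<close> quasi[rule_format, of z] by (simp add: H_def power_mult_distrib)
    qed
    have per1: "H (z + 1) = H z" for z
    proof -
      obtain s \<alpha> \<beta> where "\<forall>z. \<psi> (z + 1) = s * e2pi (\<alpha> + \<beta> * z) * \<psi> z"
        using \<psi>_quasi[of 1 0 1 "- c" a] inv1 by auto
      then show ?thesis
        by (rule per)
    qed
    have perT: "H (z + T) = H z" for z
    proof -
      obtain s \<alpha> \<beta> where "\<forall>z. \<psi> (z + T) = s * e2pi (\<alpha> + \<beta> * z) * \<psi> z"
        using \<psi>_quasi[of T 1 0 d "- b"] invT by auto
      then show ?thesis
        by (rule per)
    qed
    have "H z = H 0"
      using \<open>H holomorphic_on UNIV\<close> T per1 perT by (rule entire_doubly_periodic_constant)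
    then show ?thesis
      using \<psi>0[of z] \<psi>0[of 0] \<psi>_minus[of v] by (simp add: H_def field_simps power2_eq_square)
  qed
  show ?thesis
  proof
    show "1 / (\<psi> 0)\<^sup>2 \<noteq> 0"
      using \<psi>0 by simp
    fix z v
    have "wp_diff T' (z / J) (v / J) = f (z + v) * f (z - v) / ((f z)\<^sup>2 * (f v)\<^sup>2)"
      by (simp add: wp_diff_def f_def add_divide_distrib diff_divide_distrib)
    also have "\<dots> = (\<psi> (z + v) * \<psi> (z - v)) / ((\<psi> z)\<^sup>2 * (\<psi> v)\<^sup>2) * wp_diff T z v"
      by (simp add: f_eq wp_diff_def g_def power_mult_distrib mult_ac)
    \<comment> \<open>By \<open>\<psi>_pair\<close> all dependence on z and v cancels from the
      factor.\<close>
    also have "\<dots> = 1 / (\<psi> 0)\<^sup>2 * wp_diff T z v"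
      using \<psi>0 by (simp add: \<psi>_pair)
    finally show "wp_diff T' (z / J) (v / J) = 1 / (\<psi> 0)\<^sup>2 * wp_diff T z v" .
  qed
qed

section \<open>The Rogers--Ramanujan continued fraction\<close>

lemma rr_cfrac_qpoch:
  assumes "Im \<tau> > 0"
  defines "q \<equiv> e2pi \<tau>"
  shows "rr_cfrac \<tau> = e2pi (\<tau> / 5) * (qpoch (q ^ 4) (q ^ 5) * qpoch q (q ^ 5)) /
    (qpoch (q ^ 3) (q ^ 5) * qpoch (q\<^sup>2) (q ^ 5))"
proof -
  have "norm (q ^ 5) < 1"
    unfolding q_def e2pi_power by (rule norm_e2pi_less_1) (use assms in auto)
  note conv = convergent_prod_qpoch[OF this]
  have "(\<Prod>m. let n = Suc m in ((1 - q ^ (5 * n - 1)) * (1 - q ^ (5 * n - 4))) /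
               ((1 - q ^ (5 * n - 2)) * (1 - q ^ (5 * n - 3)))) =
    (\<Prod>m. (1 - q ^ 4 * (q ^ 5) ^ m) * (1 - q * (q ^ 5) ^ m) /
       ((1 - q ^ 3 * (q ^ 5) ^ m) * (1 - q\<^sup>2 * (q ^ 5) ^ m)))"
    by (rule prodinf_cong) (simp add: Let_def flip: power_mult power_add power_Suc)
  also have "\<dots> = (qpoch (q ^ 4) (q ^ 5) * qpoch q (q ^ 5)) / (qpoch (q ^ 3) (q ^ 5) * qpoch (q\<^sup>2) (q ^ 5))"
    unfolding qpoch_def using conv
    by (simp add: prodinf_divide[symmetric] prodinf_mult[symmetric] convergent_prod_mult)
  finally show ?thesis
    by (simp add: rr_cfrac_def Let_def q_def e2pi_def)
qed

text \<open>With period 5\<tau>, the theta products at \<tau> and 2\<tau> contain the residues 1, 4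
  and 2, 3 modulo 5. The prefactor collects 1/5 + 1/2 - 1 = -3/10.\<close>

lemma rr_cfrac_theta:
  assumes "Im \<tau> > 0"
  shows "rr_cfrac \<tau> = e2pi (- 3 * \<tau> / 10) * theta (5 * \<tau>) \<tau> / theta (5 * \<tau>) (2 * \<tau>)"
proof -
  have "e2pi (\<tau> / 5) = e2pi (- 3 * \<tau> / 10) * e2pi (- \<tau> / 2) / e2pi (- \<tau>)"
    unfolding e2pi_add[symmetric] e2pi_diff[symmetric] by (rule arg_cong[where f = e2pi]) simp
  then show ?thesis
    unfolding rr_cfrac_qpoch[OF assms] theta_def by (simp add: e2pi_power mult_ac)
qed

text \<open>Follows from \<open>qpoch_square\<close>. It moves r(\<tau>), given by the period
  5\<tau>, to the period 10\<tau> that r(2\<tau>) already has.\<close>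

lemma theta_double_period:
  assumes "Im T > 0"
  shows "theta T z = e2pi ((z + T) / 2) * theta (2 * T) z * theta (2 * T) (z + T)"
proof -
  have q2: "(e2pi T)\<^sup>2 = e2pi (2 * T)"
    by (simp add: e2pi_power)
  have "e2pi ((z + T) / 2) * e2pi (- z / 2) * e2pi (- (z + T) / 2) = e2pi (- z / 2)"
    unfolding e2pi_add[symmetric] by (rule arg_cong[where f = e2pi]) (simp add: field_simps)
  moreover have "qpoch (e2pi z) (e2pi T) = qpoch (e2pi z) (e2pi (2 * T)) * qpoch (e2pi (z + T)) (e2pi (2 * T))"
    "qpoch (e2pi (T - z)) (e2pi T) = qpoch (e2pi (2 * T - (z + T))) (e2pi (2 * T)) * qpoch (e2pi (2 * T - z)) (e2pi (2 * T))"
    using qpoch_square[OF norm_e2pi_less_1[OF assms], of "e2pi z"]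
      qpoch_square[OF norm_e2pi_less_1[OF assms], of "e2pi (T - z)"]
    by (simp_all add: q2 algebra_simps flip: e2pi_add)
  ultimately show ?thesis
    by (simp add: theta_def mult_ac)
qed

text \<open>The point P is kept arbitrary so that lattice shifts and Moebius maps can act on it; for
  period 10\<tau> and P = \<tau> this is 1/k.\<close>

definition torsion_quot :: "complex \<Rightarrow> complex \<Rightarrow> complex" where
  "torsion_quot T P = wp_diff T P (2 * P) / wp_diff T (2 * P) (4 * P)"

lemma torsion_quot_theta:
  assumes "Im T > 0"
  shows "torsion_quot T P = theta T (3 * P) * (theta T (4 * P))\<^sup>2 / (theta T P * theta T (2 * P) * theta T (6 * P))"
  using theta_minus[OF assms, of P] theta_minus[OF assms, of "2 * P"]
  by (simp add: torsion_quot_def wp_diff_def power2_eq_square)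

text \<open>Write \<open>W i j\<close> for the difference of the \<open>\<wp>\<close>-values at \<open>i * \<tau>\<close> and \<open>j * \<tau>\<close>, for
  the lattice \<open>\<int>10\<tau> + \<int>\<close>. Comparing theta factors yields \<open>W 1 2 * W 3 4 = (W 2 4)\<^sup>2\<close> and
  \<open>rr_l \<tau> = W 1 4 * W 3 4 / (W 2 3 * W 2 4)\<close>; since differences add up, everything is a rational
  function of \<open>x = W 1 2 / W 2 4\<close>.\<close>
lemma rr_torsion_quot:
  assumes \<tau>: "Im \<tau> > 0"
  defines "x \<equiv> torsion_quot (10 * \<tau>) \<tau>"
  shows "x \<noteq> 0" "x \<noteq> 1" "x \<noteq> -1"
    and "rr_cfrac \<tau> \<noteq> 0" "rr_cfrac (2 * \<tau>) \<noteq> 0"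
    and "rr_cfrac \<tau> * (rr_cfrac (2 * \<tau>))\<^sup>2 = 1 / x"
    and "rr_l \<tau> = (x + 1) / (x - 1)"
    and "torsion_quot (10 * \<tau>) (3 * \<tau>) = - 1 / x"
proof -
  define T where "T = 10 * \<tau>"
  have T: "Im T > 0"
    using \<tau> by (simp add: T_def)
  have notin: "of_int j * \<tau> \<notin> period_lattice T" if "\<not> 10 dvd j" for j
  proof
    assume "of_int j * \<tau> \<in> period_lattice T"
    then obtain m n where "of_int j * \<tau> = of_int m * (10 * \<tau>) + of_int n"
      by (auto simp: period_lattice_def T_def)
    then have "Im (of_int j * \<tau>) = Im (of_int m * (10 * \<tau>) + of_int n)"
      by simp
    then have "real_of_int j = real_of_int (10 * m)"
      using \<tau> by simp
    then have "j = 10 * m"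
      by (simp only: of_int_eq_iff)
    with that show False
      by simp
  qed
  have notin': "\<tau> \<notin> period_lattice T" "2 * \<tau> \<notin> period_lattice T" "3 * \<tau> \<notin> period_lattice T"
    "4 * \<tau> \<notin> period_lattice T" "5 * \<tau> \<notin> period_lattice T" "6 * \<tau> \<notin> period_lattice T"
    using notin[of 1] notin[of 2] notin[of 3] notin[of 4] notin[of 5] notin[of 6] by auto
  \<comment> \<open>Q is q^(1/5). Oddness and the quasi-period 10\<tau> reduce the theta values at
    6\<tau> and 7\<tau> to those at 4\<tau> and 3\<tau>.\<close>
  define Q where "Q = e2pi (\<tau> / 5)"
  define s1 where "s1 = theta T \<tau>"
  define s2 where "s2 = theta T (2 * \<tau>)"
  define s3 where "s3 = theta T (3 * \<tau>)"
  define s4 where "s4 = theta T (4 * \<tau>)"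
  define s5 where "s5 = theta T (5 * \<tau>)"
  have nz: "Q \<noteq> 0" "s1 \<noteq> 0" "s2 \<noteq> 0" "s3 \<noteq> 0" "s4 \<noteq> 0" "s5 \<noteq> 0"
    using notin' by (simp_all add: Q_def s1_def s2_def s3_def s4_def s5_def theta_eq_0_iff[OF T])
  have Qpow: "Q ^ n = e2pi (of_nat n * \<tau> / 5)" for n
    by (simp add: Q_def e2pi_power)
  have s6: "theta T (6 * \<tau>) = s4 / Q ^ 5"
    using theta_add_period[OF T, of "- 4 * \<tau>"] theta_minus[OF T, of "4 * \<tau>"]
    by (simp add: T_def s4_def Qpow e2pi_minus field_simps)
  have s7: "theta T (7 * \<tau>) = s3 / Q ^ 10"
    using theta_add_period[OF T, of "- 3 * \<tau>"] theta_minus[OF T, of "3 * \<tau>"]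
    by (simp add: T_def s3_def Qpow e2pi_minus field_simps)
  have r1: "rr_cfrac \<tau> = Q * s1 * s4 / (s2 * s3)"
  proof -
    have th5: "theta (5 * \<tau>) \<tau> = e2pi (3 * \<tau>) * s1 * theta T (6 * \<tau>)"
      "theta (5 * \<tau>) (2 * \<tau>) = e2pi (7 * \<tau> / 2) * s2 * theta T (7 * \<tau>)"
      using theta_double_period[of "5 * \<tau>" \<tau>] theta_double_period[of "5 * \<tau>" "2 * \<tau>"] \<tau>
      by (simp_all add: s1_def s2_def T_def)
    have "rr_cfrac \<tau> = e2pi (- 3 * \<tau> / 10) * e2pi (3 * \<tau>) / e2pi (7 * \<tau> / 2) * Q ^ 5 * s1 * s4 / (s2 * s3)"
      unfolding rr_cfrac_theta[OF \<tau>] th5 s6 s7 using nz by (simp add: divide_simps flip: power_add)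
    also have "e2pi (- 3 * \<tau> / 10) * e2pi (3 * \<tau>) / e2pi (7 * \<tau> / 2) * Q ^ 5 = e2pi (\<tau> / 5)"
      unfolding Qpow e2pi_add[symmetric] e2pi_diff[symmetric]
      by (rule arg_cong[where f = e2pi]) (simp add: field_simps)
    finally show ?thesis
      by (simp add: Q_def)
  qed
  have r2: "rr_cfrac (2 * \<tau>) = s2 / (Q ^ 3 * s4)"
  proof -
    have "rr_cfrac (2 * \<tau>) = e2pi (- 3 * (2 * \<tau>) / 10) * s2 / s4"
      using rr_cfrac_theta[of "2 * \<tau>"] \<tau> by (simp add: s2_def s4_def T_def)
    also have "e2pi (- 3 * (2 * \<tau>) / 10) = 1 / Q ^ 3"
      unfolding Qpow e2pi_0[symmetric] e2pi_diff[symmetric]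
      by (rule arg_cong[where f = e2pi]) (simp add: field_simps)
    finally show ?thesis
      by simp
  qed
  define W where "W = (\<lambda>i j. wp_diff T (i * \<tau>) (j * \<tau>))"
  have th: "theta T (- \<tau>) = - s1" "theta T (- (2 * \<tau>)) = - s2" "theta T (- (3 * \<tau>)) = - s3"
    using theta_minus[OF T] by (simp_all add: s1_def s2_def s3_def)
  have W12: "W 1 2 = - s3 / (s1 * s2\<^sup>2)"
    using nz th by (simp add: W_def wp_diff_def s1_def[symmetric] s2_def[symmetric] s3_def[symmetric] power2_eq_square)
  have W24: "W 2 4 = - 1 / (Q ^ 5 * s2 * s4)"
    using nz th by (simp add: W_def wp_diff_def s6 s4_def[symmetric] s2_def[symmetric] power2_eq_square)
  have W14: "W 1 4 = - s5 * s3 / (s1\<^sup>2 * s4\<^sup>2)"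
    using nz th by (simp add: W_def wp_diff_def s1_def[symmetric] s4_def[symmetric] s5_def[symmetric] power2_eq_square)
  have W23: "W 2 3 = - s5 * s1 / (s2\<^sup>2 * s3\<^sup>2)"
    using nz th by (simp add: W_def wp_diff_def s2_def[symmetric] s3_def[symmetric] s5_def[symmetric] power2_eq_square)
  have W34: "W 3 4 = - s1 / (Q ^ 10 * s3 * s4\<^sup>2)"
    using nz th by (simp add: W_def wp_diff_def s7 s3_def[symmetric] s4_def[symmetric] power2_eq_square)
  have add1: "W 1 2 + W 2 4 = W 1 4"
    unfolding W_def by (rule wp_diff_add[OF T]) (use notin' in auto)
  have add2: "W 2 3 + W 3 4 = W 2 4"
    unfolding W_def by (rule wp_diff_add[OF T]) (use notin' in auto)
  have x: "x = W 1 2 / W 2 4"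
    by (simp add: x_def torsion_quot_def W_def T_def)
  have Wnz: "W 1 2 \<noteq> 0" "W 2 4 \<noteq> 0" "W 1 4 \<noteq> 0" "W 2 3 \<noteq> 0" "W 3 4 \<noteq> 0"
    unfolding W12 W24 W14 W23 W34 using nz by auto
  have rel: "W 1 2 * W 3 4 = (W 2 4)\<^sup>2"
    unfolding W12 W24 W34 using nz by (simp add: field_simps power2_eq_square flip: power_add)
  then have W34': "W 3 4 = (W 2 4)\<^sup>2 / W 1 2"
    using Wnz by (simp add: field_simps)
  show "x \<noteq> 0"
    using Wnz by (simp add: x)
  \<comment> \<open>x = -1 would force \<open>W 1 4 = 0\<close>; likewise x = 1 would force
    \<open>W 2 3 = 0\<close> below, by way of \<open>rel\<close>.\<close>
  show "x \<noteq> -1"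
    using Wnz add1 by (auto simp: x field_simps add_eq_0_iff)
  show "x \<noteq> 1"
  proof
    assume "x = 1"
    then have "W 1 2 = W 2 4"
      using Wnz by (simp add: x)
    then have "W 2 3 = 0"
      using add2 W34' Wnz by (simp add: power2_eq_square)
    with Wnz show False
      by simp
  qed
  show "rr_cfrac \<tau> \<noteq> 0" "rr_cfrac (2 * \<tau>) \<noteq> 0"
    unfolding r1 r2 using nz by simp_all
  show "rr_cfrac \<tau> * (rr_cfrac (2 * \<tau>))\<^sup>2 = 1 / x"
    unfolding r1 r2 x W12 W24 using nz by (simp add: field_simps power2_eq_square flip: power_add power_Suc)
  have "rr_l \<tau> = W 1 4 * W 3 4 / (W 2 3 * W 2 4)"
    unfolding rr_l_def r1 r2 W14 W34 W23 W24
    using nz by (simp add: field_simps power2_eq_square flip: power_add power_Suc)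
  also have "\<dots> = (W 1 2 + W 2 4) * W 3 4 / ((W 2 4 - W 3 4) * W 2 4)"
    by (simp flip: add1 add2)
  also have "W 2 4 - W 3 4 = W 2 4 * (W 1 2 - W 2 4) / W 1 2"
    unfolding W34' using Wnz by (simp add: field_simps power2_eq_square)
  also have "(W 1 2 + W 2 4) * W 3 4 / (W 2 4 * (W 1 2 - W 2 4) / W 1 2 * W 2 4) =
      ((W 1 2 + W 2 4) / W 2 4) / ((W 1 2 - W 2 4) / W 2 4)"
    unfolding W34' using Wnz by (simp add: power2_eq_square)
  also have "\<dots> = (x + 1) / (x - 1)"
    unfolding x using Wnz by (simp add: add_divide_distrib diff_divide_distrib)
  finally show "rr_l \<tau> = (x + 1) / (x - 1)" .
  \<comment> \<open>Modulo 10 and up to sign, 3, 6, 12 become 3, 4, 2, so tripling P turns W12/W24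
    into W34/W42.\<close>
  have "10 * \<tau> \<in> period_lattice T"
    unfolding period_lattice_def T_def by (force intro: exI[of _ 1] exI[of _ 0])
  then have "wp_diff T (3 * \<tau>) (6 * \<tau>) = W 3 4" "wp_diff T (6 * \<tau>) (12 * \<tau>) = wp_diff T (4 * \<tau>) (2 * \<tau>)"
    unfolding W_def by (intro wp_diff_cong[OF T]; simp)+
  then have "torsion_quot T (3 * \<tau>) = - W 3 4 / W 2 4"
    using wp_diff_swap[OF T, of "2 * \<tau>" "4 * \<tau>"] by (simp add: torsion_quot_def W_def)
  then show "torsion_quot (10 * \<tau>) (3 * \<tau>) = - 1 / x"
    using Wnz by (simp add: T_def[symmetric] W34' x power2_eq_square)
qed

section \<open>Behaviour under modular substitutions\<close>

lemma torsion_quot_cong: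
  assumes T: "Im T > 0" and "P - P' \<in> period_lattice T \<or> P + P' \<in> period_lattice T"
  shows "torsion_quot T P = torsion_quot T P'"
proof -
  have double: "2 * z - 2 * w \<in> period_lattice T \<or> 2 * z + 2 * w \<in> period_lattice T"
    if "z - w \<in> period_lattice T \<or> z + w \<in> period_lattice T" for z w
    using that period_lattice_add[of "z - w" T "z - w"] period_lattice_add[of "z + w" T "z + w"]
    by (auto simp: algebra_simps)
  have 2: "2 * P - 2 * P' \<in> period_lattice T \<or> 2 * P + 2 * P' \<in> period_lattice T"
    using assms(2) by (rule double)
  have 4: "4 * P - 4 * P' \<in> period_lattice T \<or> 4 * P + 4 * P' \<in> period_lattice T"
    using double[OF 2] by simp
  show ?thesis
    unfolding torsion_quot_def using wp_diff_cong[OF T assms(2) 2] wp_diff_cong[OF T 2 4] by simp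
qed

text \<open>The factor \<kappa> of \<open>wp_diff_moebius\<close> cancels in the quotient.\<close>

lemma torsion_quot_moebius:
  fixes a b c d :: int
  assumes T: "Im T > 0" and det: "a * d - b * c = 1"
  defines "J \<equiv> of_int c * T + of_int d"
  shows "torsion_quot ((of_int a * T + of_int b) / J) (P / J) = torsion_quot T P"
proof -
  obtain \<kappa> where "\<kappa> \<noteq> 0"
    and "\<And>z v. wp_diff ((of_int a * T + of_int b) / J) (z / J) (v / J) = \<kappa> * wp_diff T z v"
    using wp_diff_moebius[OF T det] unfolding J_def by blast
  from this(1) this(2)[of P "2 * P"] this(2)[of "2 * P" "4 * P"] show ?thesis
    by (simp add: torsion_quot_def)
qed

section \<open>The action of Gamma0(10)\<close>

lemma det_SL2Z: "A \<in> SL2Z \<Longrightarrow> A $ 1 $ 1 * A $ 2 $ 2 - A $ 1 $ 2 * A $ 2 $ 1 = 1"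
  by (simp add: SL2Z_def det_2)

lemma Im_moebius_SL2Z_pos:
  assumes "A \<in> SL2Z" "Im \<tau> > 0"
  shows "Im (moebius A \<tau>) > 0"
  unfolding moebius_def using assms det_SL2Z by (intro Im_moebius_pos) auto

text \<open>On 10\<tau> the matrix acts with entries a, 10b, c/10, d, and the point \<tau> becomes
  a\<tau> + b. Only the class of a modulo 10 up to sign matters, and the units modulo 10 are 1, -1,
  3, -3.\<close>

lemma torsion_quot_Gamma0_10:
  assumes A: "A \<in> Gamma0 10" and \<tau>: "Im \<tau> > 0"
  shows "torsion_quot (10 * moebius A \<tau>) (moebius A \<tau>) \<in>
    {torsion_quot (10 * \<tau>) \<tau>, torsion_quot (10 * \<tau>) (3 * \<tau>)}"
proof -
  define a b c d where "a = A $ 1 $ 1" and "b = A $ 1 $ 2" and "c = A $ 2 $ 1" and "d = A $ 2 $ 2"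
  have det: "a * d - b * c = 1"
    using A det_SL2Z by (auto simp: Gamma0_def a_def b_def c_def d_def)
  obtain c' where c': "c = 10 * c'"
    using A by (auto simp: Gamma0_def c_def cong_0_iff)
  have T: "Im (10 * \<tau>) > 0"
    using \<tau> by simp
  have det2: "a * d - (10 * b) * c' = 1"
    using det by (simp add: c')
  have m: "10 * moebius A \<tau> = (of_int a * (10 * \<tau>) + of_int (10 * b)) / (of_int c' * (10 * \<tau>) + of_int d)"
    "moebius A \<tau> = (of_int a * \<tau> + of_int b) / (of_int c' * (10 * \<tau>) + of_int d)"
    using c' by (simp_all add: moebius_def a_def b_def c_def d_def algebra_simps)
  have eq: "torsion_quot (10 * moebius A \<tau>) (moebius A \<tau>) = torsion_quot (10 * \<tau>) (of_int a * \<tau> + of_int b)"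
    using torsion_quot_moebius[OF T det2, of "of_int a * \<tau> + of_int b"] unfolding m[symmetric] .
  have cong: "torsion_quot (10 * \<tau>) (of_int a * \<tau> + of_int b) = torsion_quot (10 * \<tau>) (of_int j * \<tau>)"
    if "10 dvd (a - j) \<or> 10 dvd (a + j)" for j
  proof (rule torsion_quot_cong[OF T])
    have "(\<exists>m. a = j + 10 * m) \<or> (\<exists>m. a = - j + 10 * m)"
      using that by presburger
    then consider m where "a = j + 10 * m" | m where "a = - j + 10 * m"
      by blast
    then show "of_int a * \<tau> + of_int b - of_int j * \<tau> \<in> period_lattice (10 * \<tau>) \<or>
        of_int a * \<tau> + of_int b + of_int j * \<tau> \<in> period_lattice (10 * \<tau>)"
    proof cases
      case 1
      have "of_int a * \<tau> + of_int b - of_int j * \<tau> = of_int m * (10 * \<tau>) + of_int b"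
        unfolding 1 by (simp add: algebra_simps)
      then show ?thesis
        unfolding period_lattice_def by blast
    next
      case 2
      have "of_int a * \<tau> + of_int b + of_int j * \<tau> = of_int m * (10 * \<tau>) + of_int b"
        unfolding 2 by (simp add: algebra_simps)
      then show ?thesis
        unfolding period_lattice_def by blast
    qed
  qed
  have "odd a"
  proof
    assume "even a"
    then have "even (a * d - b * c)"
      by (simp add: c')
    with det show False
      by simp
  qed
  moreover have "\<not> 5 dvd a"
  proof
    assume "5 dvd a"
    then have "5 dvd (a * d - b * c)"
      by (simp add: c')
    with det show False
      by simp
  qed
  ultimately have "(10 dvd (a - 1) \<or> 10 dvd (a + 1)) \<or> (10 dvd (a - 3) \<or> 10 dvd (a + 3))"
    by presburger
  then show ?thesis
    using cong[of 1] cong[of 3] eq by auto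
qed

section \<open>Expansions at the cusps\<close>

lemma e2pi_of_int_mult: "e2pi (of_int k * z) = e2pi z powi k"
proof (cases "k \<ge> 0")
  case True
  then show ?thesis
    using e2pi_power[of z "nat k"] by (simp add: power_int_def)
next
  case False
  then show ?thesis
    using e2pi_power[of z "nat (- k)"] e2pi_minus[of "- of_int k * z"] by (simp add: power_int_def power_inverse)
qed

text \<open>The parameter \<open>e2pi (T / 20)\<close> accommodates tenths of T and the half in the
  prefactor of \<open>theta\<close>. Reducing m modulo 10 makes both product arguments nonnegative
  powers, so only the explicit integer power can contribute a pole.\<close>

lemma theta_torsion_meromorphic:
  fixes m n :: int
  obtains g where "g meromorphic_on {0}"
    "\<And>T. Im T > 0 \<Longrightarrow> theta T ((of_int m * T + of_int n) / 10) = g (e2pi (T / 20))"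
proof
  define k where "k = m div 10"
  define j where "j = nat (m mod 10)"
  have m: "m = 10 * k + int j" and j: "j < 10"
    by (simp_all add: k_def j_def nat_less_iff)
  define C where "C = (- 1) powi k * e2pi (- of_int k * of_int n / 10) * e2pi (- of_int n / 20)"
  define \<zeta> where "\<zeta> = e2pi (of_int n / 10)"
  define g where "g = (\<lambda>Q. C * Q powi (- 10 * k\<^sup>2 - 2 * k * int j - int j) *
    qpoch (\<zeta> * Q ^ (2 * j)) (Q ^ 20) * qpoch (1 / \<zeta> * Q ^ (20 - 2 * j)) (Q ^ 20))"
  have hol: "(\<lambda>Q. qpoch (c * Q ^ i) (Q ^ 20)) meromorphic_on {0}" for c i
  proof -
    have "(\<lambda>Q. qpoch (c * Q ^ i) (Q ^ 20)) holomorphic_on ball 0 1"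
      by (intro holomorphic_intros) (auto simp: norm_power power_less_one_iff)
    then show ?thesis
      by (intro analytic_on_imp_meromorphic_on) (auto simp: analytic_at intro!: exI[of _ "ball 0 1"])
  qed
  show "g meromorphic_on {0}"
    unfolding g_def by (intro meromorphic_intros hol)
  fix T assume T: "Im T > 0"
  define Q where "Q = e2pi (T / 20)"
  have Qpow: "Q ^ i = e2pi (of_nat i * T / 20)" for i
    by (simp add: Q_def e2pi_power)
  have Qpowi: "Q powi i = e2pi (of_int i * T / 20)" for i
    by (simp add: Q_def flip: e2pi_of_int_mult)
  define z where "z = (of_nat j * T + of_int n) / 10"
  have "theta T ((of_int m * T + of_int n) / 10) = theta T (z + of_int k * T)"
    by (simp add: z_def m field_simps)
  also have "\<dots> = (- 1) powi k * (e2pi (- (of_int k)\<^sup>2 * T / 2 - of_int k * z) * e2pi (- z / 2)) *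
      qpoch (e2pi z) (e2pi T) * qpoch (e2pi (T - z)) (e2pi T)"
    unfolding theta_add_int_mult_period[OF T] by (simp add: theta_def)
  also have "e2pi (- (of_int k)\<^sup>2 * T / 2 - of_int k * z) * e2pi (- z / 2) =
      e2pi (- of_int k * of_int n / 10) * e2pi (- of_int n / 20) * Q powi (- 10 * k\<^sup>2 - 2 * k * int j - int j)"
    unfolding Qpowi e2pi_add[symmetric] by (rule arg_cong[where f = e2pi]) (simp add: z_def field_simps)
  also have "e2pi z = \<zeta> * Q ^ (2 * j)"
    unfolding Qpow \<zeta>_def e2pi_add[symmetric] by (rule arg_cong[where f = e2pi]) (simp add: z_def field_simps)
  also have "e2pi (T - z) = 1 / \<zeta> * Q ^ (20 - 2 * j)"
    unfolding Qpow \<zeta>_def e2pi_0[symmetric] e2pi_add[symmetric] e2pi_diff[symmetric]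
    by (rule arg_cong[where f = e2pi]) (use j in \<open>simp add: z_def field_simps of_nat_diff\<close>)
  also have "e2pi T = Q ^ 20"
    by (simp add: Qpow)
  finally show "theta T ((of_int m * T + of_int n) / 10) = g (e2pi (T / 20))"
    unfolding g_def Q_def[symmetric] C_def by (simp add: mult_ac)
qed

lemma torsion_quot_meromorphic:
  fixes m n :: int
  obtains g where "g meromorphic_on {0}"
    "\<And>T. Im T > 0 \<Longrightarrow> torsion_quot T ((of_int m * T + of_int n) / 10) = g (e2pi (T / 20))"
proof -
  have "\<exists>g. g meromorphic_on {0} \<and> (\<forall>T. Im T > 0 \<longrightarrow>
      theta T (of_nat i * ((of_int m * T + of_int n) / 10)) = g (e2pi (T / 20)))" for i
  proof -
    obtain g where "g meromorphic_on {0}"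
      "\<And>T. Im T > 0 \<Longrightarrow> theta T ((of_int (int i * m) * T + of_int (int i * n)) / 10) = g (e2pi (T / 20))"
      using theta_torsion_meromorphic[of "int i * m" "int i * n"] by metis
    then show ?thesis
      by (intro exI[of _ g]) (simp add: algebra_simps)
  qed
  then obtain g where mero: "\<And>i. g i meromorphic_on {0}"
    and g: "\<And>i T. Im T > 0 \<Longrightarrow> theta T (of_nat i * ((of_int m * T + of_int n) / 10)) = g i (e2pi (T / 20))"
    by metis
  show ?thesis
  proof
    show "(\<lambda>Q. g 3 Q * (g 4 Q)\<^sup>2 / (g 1 Q * g 2 Q * g 6 Q)) meromorphic_on {0}"
      by (intro meromorphic_intros mero)
    show "torsion_quot T ((of_int m * T + of_int n) / 10) =
        g 3 (e2pi (T / 20)) * (g 4 (e2pi (T / 20)))\<^sup>2 / (g 1 (e2pi (T / 20)) * g 2 (e2pi (T / 20)) * g 6 (e2pi (T / 20)))"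
      if "Im T > 0" for T
      using g[OF that, of 1] g[OF that, of 2] g[OF that, of 3] g[OF that, of 4] g[OF that, of 6]
      by (simp add: torsion_quot_theta[OF that])
  qed
qed

text \<open>The Hermite normal form of the matrix of \<open>\<tau> \<mapsto> 10 * moebius A \<tau>\<close> reduces the cusp
  \<open>A \<infinity>\<close> to \<open>\<infinity>\<close>.\<close>
lemma torsion_quot_cusp:
  assumes A: "A \<in> SL2Z"
  obtains h g where "h > 0" "g meromorphic_on {0}"
    "\<And>\<tau>. Im \<tau> > 0 \<Longrightarrow> torsion_quot (10 * moebius A \<tau>) (moebius A \<tau>) = g (e2pi (\<tau> / of_nat h))"
proof -
  define a b c d where "a = A $ 1 $ 1" and "b = A $ 1 $ 2" and "c = A $ 2 $ 1" and "d = A $ 2 $ 2"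
  have det: "a * d - b * c = 1"
    using A det_SL2Z by (auto simp: a_def b_def c_def d_def)
  \<comment> \<open>The integer matrix with rows (10a, 10b) and (c, d) will be factored as the
    unimodular matrix with rows (\<alpha>, -s), (\<gamma>, p) times the triangular one with rows (e,
    y), (0, w), where ew = 10.\<close>
  define e where "e = gcd (10 * a) c"
  obtain p s where ps: "p * (10 * a) + s * c = e"
    using bezout_int[of "10 * a" c] by (auto simp: e_def)
  obtain \<alpha> \<gamma> where \<alpha>: "10 * a = e * \<alpha>" and \<gamma>: "c = e * \<gamma>"
    unfolding e_def by (meson dvdE gcd_dvd1 gcd_dvd2)
  have "e * (\<alpha> * d - 10 * b * \<gamma>) = 10 * (a * d - b * c)"
    using \<alpha> \<gamma> by (simp add: algebra_simps)
  then have e10: "e * (\<alpha> * d - 10 * b * \<gamma>) = 10"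
    using det by simp
  define w where "w = \<alpha> * d - 10 * b * \<gamma>"
  have ew: "e * w = 10" and "e \<ge> 0"
    using e10 by (auto simp: w_def e_def)
  then have e: "e > 0" and w: "w > 0"
    by (auto simp: order_le_less zero_less_mult_iff) (metis mult_pos_neg not_less_iff_gr_or_eq mult_zero_right zero_less_numeral order_less_asym)
  define y where "y = 10 * b * p + d * s"
  have "e * (p * \<alpha> + s * \<gamma>) = e * 1"
    using ps unfolding \<alpha> by (simp add: \<gamma> algebra_simps)
  then have "p * \<alpha> + s * \<gamma> = 1"
    using e by (simp only: mult_cancel_left) auto
  then have det': "\<alpha> * p - (- s) * \<gamma> = 1"
    by (simp add: mult_ac)
  have row1: "\<alpha> * y - s * w = 10 * b"
  proof -
    have "\<alpha> * y - s * w = 10 * b * (\<alpha> * p - (- s) * \<gamma>)"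
      by (simp add: y_def w_def algebra_simps)
    with det' show ?thesis by simp
  qed
  have row2: "\<gamma> * y + p * w = d"
  proof -
    have "\<gamma> * y + p * w = d * (\<alpha> * p - (- s) * \<gamma>)"
      by (simp add: y_def w_def algebra_simps)
    with det' show ?thesis by simp
  qed
  obtain g where mero: "g meromorphic_on {0}"
    and g: "\<And>T. Im T > 0 \<Longrightarrow> torsion_quot T ((of_int \<alpha> * T + of_int (- s)) / 10) = g (e2pi (T / 20))"
    using torsion_quot_meromorphic[of \<alpha> "- s"] by metis
  \<comment> \<open>T/20 = (e\<tau> + y)/(20w), so the local parameter at this cusp has width
    20w.\<close>
  define h where "h = nat (20 * w)"
  have h: "of_nat h = (20 * of_int w :: complex)"
    using w by (simp add: h_def)
  define \<zeta> where "\<zeta> = e2pi (of_int y / of_nat h)"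
  show ?thesis
  proof
    show "h > 0"
      using w by (simp add: h_def)
    show "(\<lambda>R. g (\<zeta> * R ^ nat e)) meromorphic_on {0}"
      by (rule meromorphic_on_compose[OF mero]) (use e in \<open>auto intro!: analytic_intros\<close>)
    fix \<tau> assume \<tau>: "Im \<tau> > 0"
    define T where "T = (of_int e * \<tau> + of_int y) / of_int w"
    have T: "Im T > 0"
      using \<tau> e w by (simp add: T_def)
    have w0: "(of_int w :: complex) \<noteq> 0"
      using w by simp
    define J where "J = of_int c * \<tau> + of_int d"
    have J0: "J \<noteq> 0"
      unfolding J_def by (rule Im_moebius_pos[OF \<tau> det])
    have "of_int \<gamma> * T + of_int p = (of_int (e * \<gamma>) * \<tau> + of_int (\<gamma> * y + p * w)) / of_int w"
      using w0 by (simp add: T_def field_simps)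
    then have J': "of_int \<gamma> * T + of_int p = J / of_int w"
      unfolding row2 \<gamma>[symmetric] by (simp add: J_def)
    have "of_int \<alpha> * T + of_int (- s) = (of_int (e * \<alpha>) * \<tau> + of_int (\<alpha> * y - s * w)) / of_int w"
      using w0 by (simp add: T_def field_simps)
    then have N': "of_int \<alpha> * T + of_int (- s) = 10 * (of_int a * \<tau> + of_int b) / of_int w"
      unfolding row1 \<alpha>[symmetric] by (simp add: algebra_simps)
    have mo: "moebius A \<tau> = (of_int a * \<tau> + of_int b) / J"
      by (simp add: moebius_def J_def a_def b_def c_def d_def)
    \<comment> \<open>The unimodular factor can now be removed by
      \<open>torsion_quot_moebius\<close>, leaving a 10-torsion point of the lattice of T.\<close>
    have "torsion_quot (10 * moebius A \<tau>) (moebius A \<tau>) =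
        torsion_quot ((of_int \<alpha> * T + of_int (- s)) / (of_int \<gamma> * T + of_int p))
          (((of_int \<alpha> * T + of_int (- s)) / 10) / (of_int \<gamma> * T + of_int p))"
      unfolding J' N' mo by (rule arg_cong2[where f = torsion_quot]) (use w0 J0 in \<open>simp_all add: field_simps\<close>)
    also have "\<dots> = torsion_quot T ((of_int \<alpha> * T + of_int (- s)) / 10)"
      using det' by (rule torsion_quot_moebius[OF T])
    also have "\<dots> = g (e2pi (T / 20))"
      by (rule g[OF T])
    also have "e2pi (T / 20) = \<zeta> * e2pi (\<tau> / of_nat h) ^ nat e"
      unfolding \<zeta>_def e2pi_power e2pi_add[symmetric] h
      by (rule arg_cong[where f = e2pi]) (use e w0 in \<open>simp add: T_def field_simps\<close>)
    finally show "torsion_quot (10 * moebius A \<tau>) (moebius A \<tau>) = g (\<zeta> * e2pi (\<tau> / of_nat h) ^ nat e)" .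
  qed
qed

section \<open>Polynomiality in l - 1/l\<close>

abbreviation (input) rat_poly_eval :: "rat poly \<Rightarrow> complex \<Rightarrow> complex" where
  "rat_poly_eval Q \<equiv> poly (map_poly of_rat Q)"

lemma rat_poly_eval_add: "rat_poly_eval (P + Q) t = rat_poly_eval P t + rat_poly_eval Q t"
proof -
  have "map_poly of_rat (P + Q) = map_poly of_rat P + (map_poly of_rat Q :: complex poly)"
    by (rule poly_eqI) (simp add: coeff_map_poly of_rat_add)
  then show ?thesis
    by simp
qed

lemma rat_poly_eval_mult: "rat_poly_eval (P * Q) t = rat_poly_eval P t * rat_poly_eval Q t"
proof -
  have "map_poly of_rat (P * Q) = map_poly of_rat P * (map_poly of_rat Q :: complex poly)"
    by (rule poly_eqI) (simp add: coeff_map_poly coeff_mult of_rat_sum of_rat_mult)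
  then show ?thesis
    by simp
qed

text \<open>Suited to three-term recurrences that can be run in both directions.\<close>

lemma int_two_step_induct:
  fixes R :: "int \<Rightarrow> bool"
  assumes "R 0" "R 1" and up: "\<And>m. R m \<Longrightarrow> R (m + 1) \<Longrightarrow> R (m + 2)"
    and down: "\<And>m. R (m + 1) \<Longrightarrow> R (m + 2) \<Longrightarrow> R m"
  shows "R m"
proof -
  have "R m \<and> R (m + 1)"
  proof (induction m rule: int_induct[where k = 0])
    case (step1 i)
    then show ?case
      using up[of i] by (simp add: add.assoc)
  next
    case (step2 i)
    then show ?case
      using down[of "i - 1"] by (simp add: add.commute)
  qed (use assms in auto)
  then show ?thesis
    by simp
qed

text \<open>\<open>twisted_sum\<close> is invariant under the involution \<open>(k, l) \<mapsto> (-1/k, -1/l)\<close>.\<close>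
definition twisted_sum :: "complex \<Rightarrow> complex \<Rightarrow> int \<Rightarrow> int \<Rightarrow> complex" where
  "twisted_sum k l n m = k powi n * l powi m + (- 1) powi (n + m) / (k powi n * l powi m)"

text \<open>The powers of l and of -1/l both solve this recurrence, since l and -1/l are the roots
  of X^2 - (l - 1/l) X - 1.\<close>

lemma twisted_sum_rec_right:
  assumes "k \<noteq> 0" "l \<noteq> 0"
  shows "twisted_sum k l n (m + 2) = (l - 1 / l) * twisted_sum k l n (m + 1) + twisted_sum k l n m"
proof -
  have "l powi (m + 1) = l powi m * l" "l powi (m + 2) = l powi m * (l * l)"
    using assms by (simp_all add: power_int_add power2_eq_square)
  moreover have "(- 1 :: complex) powi (n + (m + 1)) = - ((- 1) powi (n + m))"
    "(- 1 :: complex) powi (n + (m + 2)) = (- 1) powi (n + m)"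
    by (simp_all add: power_int_add)
  ultimately show ?thesis
    using assms by (simp add: twisted_sum_def field_simps)
qed

lemma twisted_sum_swap: "twisted_sum k l n m = twisted_sum l k m n"
  by (simp add: twisted_sum_def mult.commute add.commute)

lemma twisted_sum_rec_left:
  assumes "k \<noteq> 0" "l \<noteq> 0"
  shows "twisted_sum k l (n + 2) m = (k - 1 / k) * twisted_sum k l (n + 1) m + twisted_sum k l n m"
  using twisted_sum_rec_right[OF assms(2,1)] by (simp add: twisted_sum_swap[of k l])

lemma twisted_sum_minus:
  assumes "k \<noteq> 0" "l \<noteq> 0"
  shows "twisted_sum k l (- n) (- m) = (- 1) powi (n + m) * twisted_sum k l n m"
proof -
  have "(- 1 :: complex) powi (- n + - m) = inverse ((- 1) powi (n + m))"
    by (simp flip: power_int_minus)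
  also have "\<dots> = (- 1) powi (n + m)"
    by (cases "even (n + m)") simp_all
  finally have "(- 1 :: complex) powi (- n + - m) = (- 1) powi (n + m)" .
  moreover have "(- 1 :: complex) powi (n + m) * (- 1) powi (n + m) = 1"
    by (simp flip: power_int_mult_distrib)
  ultimately show ?thesis
    using assms by (simp add: twisted_sum_def power_int_minus field_simps)
qed

text \<open>Since t (k - 1/k) = -4, multiplying by t^n clears the denominators of the recurrence in
  n. Four initial values with n, m in {0, 1} then suffice, and \<open>twisted_sum_minus\<close>
  covers negative n.\<close>

lemma twisted_sum_polynomial:
  fixes n m :: int
  obtains Q :: "rat poly" where "\<And>x k l t. x \<noteq> 0 \<Longrightarrow> x \<noteq> 1 \<Longrightarrow> x \<noteq> -1 \<Longrightarrow> k = 1 / x \<Longrightarrow>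
    l = (x + 1) / (x - 1) \<Longrightarrow> t = l - 1 / l \<Longrightarrow> t ^ nat \<bar>n\<bar> * twisted_sum k l n m = rat_poly_eval Q t"
proof -
  define \<Phi> where "\<Phi> = {(x, k, l, t :: complex). x \<noteq> 0 \<and> x \<noteq> 1 \<and> x \<noteq> -1 \<and> k = 1 / x \<and>
    l = (x + 1) / (x - 1) \<and> t = l - 1 / l}"
  \<comment> \<open>Q is chosen before the tuple in \<Phi>, so one polynomial serves all
    parameters.\<close>
  define R where "R = (\<lambda>n m. \<exists>Q :: rat poly. \<forall>(x, k, l, t) \<in> \<Phi>.
    t ^ n * twisted_sum k l (int n) m = rat_poly_eval Q t)"
  have ne: "x \<noteq> 0" "x - 1 \<noteq> 0" "x + 1 \<noteq> 0" "k \<noteq> 0" "l \<noteq> 0" "k = 1 / x" "l = (x + 1) / (x - 1)"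
      "t = l - 1 / l"
    if "(x, k, l, t) \<in> \<Phi>" for x k l t
    using that by (auto simp: \<Phi>_def add_eq_0_iff2)
  have t_eq: "t = 4 * x / ((x - 1) * (x + 1))" "t * (k - 1 / k) = - 4" if "(x, k, l, t) \<in> \<Phi>" for x k l t
  proof -
    note ne = ne[OF that]
    show t: "t = 4 * x / ((x - 1) * (x + 1))"
      unfolding ne(8) ne(7) using ne(1-3) by (simp add: divide_simps) (simp add: algebra_simps)
    have "k - 1 / k = - ((x - 1) * (x + 1)) / x"
      unfolding ne(6) using ne(1-3) by (simp add: divide_simps) (simp add: algebra_simps)
    then show "t * (k - 1 / k) = - 4"
      unfolding t using ne(1-3) by simp
  qed
  have rec: "twisted_sum k l n (m + 2) = t * twisted_sum k l n (m + 1) + twisted_sum k l n m"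
    if "(x, k, l, t) \<in> \<Phi>" for x k l t n m
    unfolding ne(8)[OF that] using ne(4,5)[OF that] by (rule twisted_sum_rec_right)
  have R_intro: "R n m" if "\<And>x k l t. (x, k, l, t) \<in> \<Phi> \<Longrightarrow> t ^ n * twisted_sum k l (int n) m = rat_poly_eval Q t" for Q n m
    using that unfolding R_def by blast
  have R_right: "R n m" if R0: "R n 0" and R1: "R n 1" for n m
  proof (induction m rule: int_two_step_induct)
    case (3 m)
    then obtain P Q where PQ: "\<And>x k l t. (x, k, l, t) \<in> \<Phi> \<Longrightarrow> t ^ n * twisted_sum k l (int n) m = rat_poly_eval P t"
      "\<And>x k l t. (x, k, l, t) \<in> \<Phi> \<Longrightarrow> t ^ n * twisted_sum k l (int n) (m + 1) = rat_poly_eval Q t"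
      unfolding R_def by blast
    show ?case
    proof (rule R_intro)
      fix x k l t assume *: "(x, k, l, t) \<in> \<Phi>"
      have "t ^ n * twisted_sum k l (int n) (m + 2) =
          t * (t ^ n * twisted_sum k l (int n) (m + 1)) + t ^ n * twisted_sum k l (int n) m"
        unfolding rec[OF *] by (simp add: algebra_simps)
      then show "t ^ n * twisted_sum k l (int n) (m + 2) = rat_poly_eval ([:0, 1:] * Q + P) t"
        using PQ[OF *] by (simp add: rat_poly_eval_add rat_poly_eval_mult map_poly_pCons)
    qed
  next
    case (4 m)
    then obtain P Q where PQ: "\<And>x k l t. (x, k, l, t) \<in> \<Phi> \<Longrightarrow> t ^ n * twisted_sum k l (int n) (m + 1) = rat_poly_eval P t"
      "\<And>x k l t. (x, k, l, t) \<in> \<Phi> \<Longrightarrow> t ^ n * twisted_sum k l (int n) (m + 2) = rat_poly_eval Q t"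
      unfolding R_def by blast
    show ?case
    proof (rule R_intro)
      fix x k l t assume *: "(x, k, l, t) \<in> \<Phi>"
      have "t ^ n * twisted_sum k l (int n) m =
          t ^ n * twisted_sum k l (int n) (m + 2) + (- t) * (t ^ n * twisted_sum k l (int n) (m + 1))"
        unfolding rec[OF *] by (simp add: algebra_simps)
      then show "t ^ n * twisted_sum k l (int n) m = rat_poly_eval (Q + [:0, - 1:] * P) t"
        using PQ[OF *] unfolding rat_poly_eval_add rat_poly_eval_mult by (simp add: map_poly_pCons of_rat_minus)
    qed
  qed (use R0 R1 in auto)
  have "R 0 0"
    by (rule R_intro[of _ _ "[:2:]"]) (simp add: twisted_sum_def map_poly_pCons)
  moreover have "R 0 1"
    by (rule R_intro[of _ _ "[:0, 1:]"]) (simp add: twisted_sum_def map_poly_pCons, metis ne(8))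
  ultimately have R0: "R 0 m" for m
    by (rule R_right)
  have "R 1 0"
    by (rule R_intro[of _ _ "[:- 4:]"])
      (simp add: twisted_sum_def map_poly_pCons of_rat_minus t_eq(2))
  moreover have "R 1 1"
  \<comment> \<open>Expressing k, l and t through x gives t (kl + 1/(kl)) = t^2 - 2t + 4.\<close>
  proof (rule R_intro[of _ _ "[:4, - 2, 1:]"])
    fix x k l t assume *: "(x, k, l, t) \<in> \<Phi>"
    note ne = ne[OF *]
    have eq: "k * l = (x + 1) / (x * (x - 1))"
      unfolding ne(6,7) by simp
    have "t * (k * l + 1 / (k * l)) = t\<^sup>2 - 2 * t + 4"
      unfolding eq t_eq(1)[OF *] using ne(1-3)
      by (simp add: divide_simps) (simp add: algebra_simps power2_eq_square power4_eq_xxxx power3_eq_cube)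
    then show "t ^ 1 * twisted_sum k l (int 1) 1 = rat_poly_eval [:4, - 2, 1:] t"
      by (simp add: twisted_sum_def map_poly_pCons of_rat_minus algebra_simps power2_eq_square)
  qed
  ultimately have R1: "R 1 m" for m
    by (rule R_right)
  have R: "R n m \<and> R (Suc n) m" for n m
  proof (induction n)
    case (Suc n)
    then obtain P Q where PQ: "\<And>x k l t. (x, k, l, t) \<in> \<Phi> \<Longrightarrow> t ^ n * twisted_sum k l (int n) m = rat_poly_eval P t"
      "\<And>x k l t. (x, k, l, t) \<in> \<Phi> \<Longrightarrow> t ^ Suc n * twisted_sum k l (int (Suc n)) m = rat_poly_eval Q t"
      unfolding R_def by blast
    have "R (Suc (Suc n)) m"
    proof (rule R_intro)
      fix x k l t assume *: "(x, k, l, t) \<in> \<Phi>"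
      have "twisted_sum k l (int (Suc (Suc n))) m = (k - 1 / k) * twisted_sum k l (int (Suc n)) m + twisted_sum k l (int n) m"
        using twisted_sum_rec_left[OF ne(4,5)[OF *], of "int n" m] by (simp add: add.commute)
      \<comment> \<open>One power of t is absorbed by k - 1/k; the older term keeps t^2.\<close>
      then have "t ^ Suc (Suc n) * twisted_sum k l (int (Suc (Suc n))) m =
          (t * (k - 1 / k)) * (t ^ Suc n * twisted_sum k l (int (Suc n)) m) + t\<^sup>2 * (t ^ n * twisted_sum k l (int n) m)"
        by (simp only:) (simp add: algebra_simps power2_eq_square)
      also have "\<dots> = - 4 * rat_poly_eval Q t + t\<^sup>2 * rat_poly_eval P t"
        using t_eq(2)[OF *] PQ[OF *] by simp
      finally show "t ^ Suc (Suc n) * twisted_sum k l (int (Suc (Suc n))) m =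
          rat_poly_eval ([:- 4:] * Q + [:0, 0, 1:] * P) t"
        unfolding rat_poly_eval_add rat_poly_eval_mult by (simp add: map_poly_pCons of_rat_minus power2_eq_square)
    qed
    with Suc show ?case
      by simp
  qed (use R0 R1 in auto)
  show ?thesis
  proof (cases "n \<ge> 0")
    case True
    from R[of "nat n" m] obtain Q where "\<forall>(x, k, l, t) \<in> \<Phi>. t ^ nat n * twisted_sum k l (int (nat n)) m = rat_poly_eval Q t"
      unfolding R_def by blast
    with True show ?thesis
      by (intro that[of Q]) (auto simp: \<Phi>_def)
  next
    case False
    from R[of "nat (- n)" "- m"] obtain Q where
      "\<forall>(x, k, l, t) \<in> \<Phi>. t ^ nat (- n) * twisted_sum k l (int (nat (- n))) (- m) = rat_poly_eval Q t"
      unfolding R_def by blast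
    then have Q: "t ^ nat (- n) * twisted_sum k l (- n) (- m) = rat_poly_eval Q t" if "(x, k, l, t) \<in> \<Phi>" for x k l t
      using that False by auto
    have sgn: "(- 1 :: complex) powi (n + m) = of_rat ((- 1) powi (n + m))"
      by (cases "even (n + m)") (simp_all add: of_rat_minus)
    show ?thesis
    proof (rule that)
      fix x k l t :: complex
      assume "x \<noteq> 0" "x \<noteq> 1" "x \<noteq> -1" "k = 1 / x" "l = (x + 1) / (x - 1)" "t = l - 1 / l"
      then have *: "(x, k, l, t) \<in> \<Phi>"
        by (simp add: \<Phi>_def)
      have "twisted_sum k l n m = (- 1) powi (n + m) * twisted_sum k l (- n) (- m)"
        using twisted_sum_minus[OF ne(4,5)[OF *], of n m] by (cases "even (n + m)") simp_all
      then show "t ^ nat \<bar>n\<bar> * twisted_sum k l n m = rat_poly_eval ([:(- 1) powi (n + m):] * Q) t"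
        using Q[OF *] False unfolding rat_poly_eval_mult by (simp add: sgn map_poly_pCons mult_ac)
    qed
  qed
qed

text \<open>With m = b - 2n, the exponents of r(\<tau>) and r(2\<tau>) in k^n l^m are n - 2m = a and
  2n + m = b. The signs agree because b - a = n + 3m.\<close>

lemma rr_f_eq_twisted_sum:
  assumes r: "rr_cfrac \<tau> \<noteq> 0" "rr_cfrac (2 * \<tau>) \<noteq> 0" and n: "a + 2 * b = 5 * n"
  shows "rr_f a b \<tau> = twisted_sum (rr_cfrac \<tau> * (rr_cfrac (2 * \<tau>))\<^sup>2) (rr_l \<tau>) n (b - 2 * n)"
proof -
  define u v where "u = rr_cfrac \<tau>" and "v = rr_cfrac (2 * \<tau>)"
  have uv: "u \<noteq> 0" "v \<noteq> 0"
    using r by (simp_all add: u_def v_def)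
  have a: "a = 5 * n - 2 * b"
    using n by simp
  have sq: "(z\<^sup>2) powi i = z powi (2 * i)" for z :: complex and i
    by (simp add: power_int_mult)
  have "(u * v\<^sup>2) powi n * (v / u\<^sup>2) powi (b - 2 * n) =
      (u powi n * v powi (2 * n)) * (v powi (b - 2 * n) / u powi (2 * (b - 2 * n)))"
    by (simp only: power_int_mult_distrib power_int_divide_distrib sq)
  also have "\<dots> = u powi (n - 2 * (b - 2 * n)) * v powi (2 * n + (b - 2 * n))"
    unfolding power_int_diff[OF disjI1[OF uv(1)]] power_int_add[OF disjI1[OF uv(2)]] by simp
  also have "\<dots> = u powi a * v powi b"
    by (simp add: a algebra_simps)
  finally have prod: "(u * v\<^sup>2) powi n * (v / u\<^sup>2) powi (b - 2 * n) = u powi a * v powi b" .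
  have "even (b - a) = even (n + (b - 2 * n))"
    unfolding a by presburger
  then have "(- 1 :: complex) powi (b - a) = (- 1) powi (n + (b - 2 * n))"
    by (cases "even (b - a)") simp_all
  then show ?thesis
    unfolding rr_f_def twisted_sum_def rr_l_def u_def[symmetric] v_def[symmetric] prod by simp
qed

section \<open>Modularity\<close>

lemma open_upper_half_plane: "open upper_half_plane"
  unfolding upper_half_plane_def by (rule open_halfspace_Im_gt)

lemma rr_cfrac_holomorphic: "rr_cfrac holomorphic_on upper_half_plane"
proof (rule holomorphic_transform)
  \<comment> \<open>Division by 0 yields 0, so a vanishing denominator would contradict r(\<tau>)
    being nonzero.\<close>
  have "theta (5 * \<tau>) (2 * \<tau>) \<noteq> 0" if "\<tau> \<in> upper_half_plane" for \<tau>
    using that rr_torsion_quot(4)[of \<tau>] rr_cfrac_theta[of \<tau>] by (auto simp: upper_half_plane_def)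
  then show "(\<lambda>\<tau>. e2pi (- 3 * \<tau> / 10) * theta (5 * \<tau>) \<tau> / theta (5 * \<tau>) (2 * \<tau>)) holomorphic_on upper_half_plane"
    by (intro holomorphic_intros holomorphic_theta open_upper_half_plane) (auto simp: upper_half_plane_def)
qed (simp add: upper_half_plane_def rr_cfrac_theta)

lemma rr_f_holomorphic: "rr_f a b holomorphic_on upper_half_plane"
proof -
  have "(rr_cfrac \<circ> (\<lambda>\<tau>. 2 * \<tau>)) holomorphic_on upper_half_plane"
    by (rule holomorphic_on_compose_gen[OF _ rr_cfrac_holomorphic])
      (auto simp: upper_half_plane_def intro!: holomorphic_intros)
  then have "(\<lambda>\<tau>. rr_cfrac (2 * \<tau>)) holomorphic_on upper_half_plane"
    by (simp add: o_def)
  then show ?thesis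
    unfolding rr_f_def using rr_torsion_quot(4,5) rr_cfrac_holomorphic
    by (intro holomorphic_intros) (auto simp: upper_half_plane_def)
qed

lemma meromorphic_on_poly:
  assumes "f meromorphic_on A"
  shows "(\<lambda>w. poly p (f w)) meromorphic_on A"
  unfolding poly_altdef by (intro meromorphic_intros assms)

theorem theorem3p3:
  fixes a b :: int
  assumes "(a, b) \<noteq> (0, 0)"
    and "[a = 3 * b] (mod 5)"
  shows "modular_function_on (Gamma0 10) (rr_f a b) \<and>
    (\<exists>Q :: rat poly. \<forall>\<tau>\<in>upper_half_plane.
       (rr_l \<tau> - 1 / rr_l \<tau>) ^ nat (\<bar>a + 2 * b\<bar> div 5) * rr_f a b \<tau> =
       poly (map_poly of_rat Q) (rr_l \<tau> - 1 / rr_l \<tau>))"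
proof -
  have "5 dvd (a - 3 * b)"
    using assms(2) by (simp add: cong_iff_dvd_diff)
  then have "5 dvd (a + 2 * b)"
    by presburger
  then obtain n where n: "a + 2 * b = 5 * n"
    by (elim dvdE)
  define N where "N = nat \<bar>n\<bar>"
  have N: "nat (\<bar>a + 2 * b\<bar> div 5) = N"
    by (simp add: n N_def abs_mult)
  obtain Q where Q: "\<And>x k l t. x \<noteq> 0 \<Longrightarrow> x \<noteq> 1 \<Longrightarrow> x \<noteq> -1 \<Longrightarrow> k = 1 / x \<Longrightarrow>
      l = (x + 1) / (x - 1) \<Longrightarrow> t = l - 1 / l \<Longrightarrow> t ^ N * twisted_sum k l n (b - 2 * n) = rat_poly_eval Q t"
    unfolding N_def using twisted_sum_polynomial[of n "b - 2 * n"] by metis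
  have poly_eq: "(rr_l \<tau> - 1 / rr_l \<tau>) ^ N * rr_f a b \<tau> = rat_poly_eval Q (rr_l \<tau> - 1 / rr_l \<tau>)"
    if "Im \<tau> > 0" for \<tau>
    unfolding rr_f_eq_twisted_sum[OF rr_torsion_quot(4,5)[OF that] n]
    by (rule Q[OF rr_torsion_quot(1,2,3,6,7)[OF that] refl])
  define x where "x = (\<lambda>\<tau>. torsion_quot (10 * \<tau>) \<tau>)"
  \<comment> \<open>\<open>G\<close> expresses t = l - 1/l through x = 1/k. As t is nonzero on the
    half-plane, dividing the polynomial identity by t^N recovers \<open>rr_f\<close> as the rational
    function \<open>F\<close> of x.\<close>
  define G where "G = (\<lambda>y :: complex. 4 * y / ((y - 1) * (y + 1)))"
  define F where "F = (\<lambda>y. rat_poly_eval Q (G y) / (G y) ^ N)"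
  have f_eq: "rr_f a b \<tau> = F (x \<tau>)" if "Im \<tau> > 0" for \<tau>
  proof -
    have x: "x \<tau> \<noteq> 0" "x \<tau> - 1 \<noteq> 0" "x \<tau> + 1 \<noteq> 0"
      using rr_torsion_quot(1-3)[OF that] by (auto simp: x_def add_eq_0_iff2)
    have l: "rr_l \<tau> = (x \<tau> + 1) / (x \<tau> - 1)"
      using rr_torsion_quot(7)[OF that] by (simp add: x_def)
    have "rr_l \<tau> - 1 / rr_l \<tau> = G (x \<tau>)"
      unfolding l G_def
      using x by (simp add: divide_simps) (simp add: algebra_simps)
    moreover have "G (x \<tau>) \<noteq> 0"
      using x by (simp add: G_def)
    ultimately show ?thesis
      using poly_eq[OF that] by (simp add: F_def eq_divide_eq mult.commute)
  qed
  \<comment> \<open>-1/x is the only other value that x can take after a substitution from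
    Gamma0(10).\<close>
  have "G (- 1 / y) = G y" if "y \<noteq> 0" for y
  proof -
    have "(- 1 / y - 1) * (- 1 / y + 1) = - ((y - 1) * (y + 1)) / y\<^sup>2"
      using that by (simp add: divide_simps) (simp add: algebra_simps power2_eq_square)
    then show ?thesis
      using that by (simp add: G_def power2_eq_square)
  qed
  then have F_inv: "F (- 1 / y) = F y" if "y \<noteq> 0" for y
    using that by (simp add: F_def)
  have "modular_function_on (Gamma0 10) (rr_f a b)"
    unfolding modular_function_on_def
  proof (intro conjI ballI)
    show "rr_f a b nicely_meromorphic_on upper_half_plane"
      using rr_f_holomorphic open_upper_half_plane
      by (intro analytic_on_imp_nicely_meromorphic_on) (simp add: analytic_on_open)
  next
    fix A \<tau> assume A: "A \<in> Gamma0 10" and "\<tau> \<in> upper_half_plane"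
    then have \<tau>: "Im \<tau> > 0" and \<tau>': "Im (moebius A \<tau>) > 0"
      by (auto simp: upper_half_plane_def Gamma0_def intro!: Im_moebius_SL2Z_pos)
    have "x (moebius A \<tau>) = x \<tau> \<or> x (moebius A \<tau>) = - 1 / x \<tau>"
      using torsion_quot_Gamma0_10[OF A \<tau>] rr_torsion_quot(8)[OF \<tau>] by (auto simp: x_def)
    then have "F (x (moebius A \<tau>)) = F (x \<tau>)"
      using F_inv[of "x \<tau>"] rr_torsion_quot(1)[OF \<tau>] by (auto simp: x_def)
    then show "rr_f a b (moebius A \<tau>) = rr_f a b \<tau>"
      by (simp add: f_eq \<tau> \<tau>')
  next
    fix A assume A: "A \<in> SL2Z"
    obtain h g where h: "h > 0" and mero: "g meromorphic_on {0}"
      and g: "\<And>\<tau>. Im \<tau> > 0 \<Longrightarrow> x (moebius A \<tau>) = g (e2pi (\<tau> / of_nat h))"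
      using torsion_quot_cusp[OF A] unfolding x_def by blast
    \<comment> \<open>\<open>F\<close> is rational, so meromorphy at each cusp is inherited from
      x.\<close>
    have "(\<lambda>R. F (g R)) meromorphic_on {0}"
      unfolding F_def G_def by (intro meromorphic_intros meromorphic_on_poly mero)
    moreover have "rr_f a b (moebius A \<tau>) = F (g (exp (2 * of_real pi * \<i> * \<tau> / of_nat h)))" if "Im \<tau> > 0" for \<tau>
      using g[OF that] f_eq[OF Im_moebius_SL2Z_pos[OF A that]] by (simp add: e2pi_def)
    ultimately show "meromorphic_at_ii_inf (\<lambda>\<tau>. rr_f a b (moebius A \<tau>))"
      unfolding meromorphic_at_ii_inf_def using h by blast
  qed
  moreover have "\<forall>\<tau>\<in>upper_half_plane. (rr_l \<tau> - 1 / rr_l \<tau>) ^ nat (\<bar>a + 2 * b\<bar> div 5) * rr_f a b \<tau> =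
       poly (map_poly of_rat Q) (rr_l \<tau> - 1 / rr_l \<tau>)"
    unfolding N using poly_eq by (simp add: upper_half_plane_def)
  ultimately show ?thesis
    by blast
qed

end
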